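(* Let $\mathfrak X$ be a class of solvable groups closed under taking subgroups and quotients. (1) If $\operatorname{AT}(G,\phi,G')$ holds for every $G\in\mathfrak X$ and every $\phi\in\operatorname{End}(G)$, then the Addition Theorem holds in $\mathfrak X$ for endomorphisms, i.e. $\operatorname{AT}(G,\phi,H)$ holds for every $G\in\mathfrak X$, every $\phi\in\operatorname{End}(G)$ and every $\phi$-invariant normal subgroup $H$ of $G$. (2) If $\operatorname{AT}(G,\phi,Z(G))$ holds for every nilpotent group $G\in\mathfrak X$ and every $\phi\in\operatorname{Aut}(G)$, then $\operatorname{AT}(G,\phi,H)$ holds for every nilpotent group $G\in\mathfrak X$, every $\phi\in\operatorname{Aut}(G)$ and every $\phi$-stable normal subgroup $H$ of $G$.
   Context: Algebraic entropy: let $G$ be a (not necessarily abelian) group and $\phi\in\operatorname{End}(G)$. For a nonempty finite subset $X$ of $G$ and a positive integer $n$, the $n$-th $\phi$-trajectory of $X$ is $T_n(\phi,X)=X\cdot\phi(X)\cdots\phi^{n-1}(X)$ (product of subsets). Put $H(\phi,X)=\lim_{n\to\infty}\frac{\log|T_n(\phi,X)|}{n}$ (the limit exists), and $h(\phi)=\sup\{H(\phi,X): X \text{ a nonempty finite subset of } G\}\in[0,\infty]$. A subgroup $H$ of $G$ is $\phi$-invariant if $\phi(H)\subseteq H$; it is $\phi$-stable if $\phi\in\operatorname{Aut}(G)$ and $\phi(H)=H$. For a $\phi$-invariant normal subgroup $H$ of $G$, $\phi\upharpoonright_H\in\operatorname{End}(H)$ is the restriction and $\bar\phi\in\operatorname{End}(G/H)$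 is the induced endomorphism. We say that $\operatorname{AT}(G,\phi,H)$ holds if $h(\phi)=h(\phi\upharpoonright_H)+h(\bar\phi)$ (in $[0,\infty]$). $G'$ is the derived (commutator) subgroup of $G$ and $Z(G)$ is the center of $G$. *)

theory Defs
  imports "HOL-Algebra.Solvable_Groups" "HOL-Library.Extended_Real"
begin

section \<open>Algebraic entropy\<close>

text \<open>Starting the recursion at the trivial product \<open>{\<one>}\<close> gives
  \<open>trajectory G \<phi> X n = X <#> \<phi> ` X <#> \<dots> <#> (\<phi> ^^ (n - 1)) ` X\<close>
  for all \<open>n \<ge> 1\<close> and \<open>X \<subseteq> carrier G\<close>.\<close>

primrec trajectory :: "('a, 'b) monoid_scheme \<Rightarrow> ('a \<Rightarrow> 'a) \<Rightarrow> 'a set \<Rightarrow> nat \<Rightarrow> 'a set" where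
  "trajectory G \<phi> X 0 = {\<one>\<^bsub>G\<^esub>}"
| "trajectory G \<phi> X (Suc n) = trajectory G \<phi> X n <#>\<^bsub>G\<^esub> (\<phi> ^^ n) ` X"

lemma (in group) trajectory_1: "X \<subseteq> carrier G \<Longrightarrow> trajectory G \<phi> X 1 = X"
  by (force simp: set_mult_def)

text \<open>For an endomorphism \<open>\<phi>\<close> and a finite nonempty \<open>X\<close> this limit exists, because
  \<open>n \<mapsto> ln (card (trajectory G \<phi> X n))\<close> is subadditive and nonnegative.\<close>

definition entropy_on :: "('a, 'b) monoid_scheme \<Rightarrow> ('a \<Rightarrow> 'a) \<Rightarrow> 'a set \<Rightarrow> real" where
  "entropy_on G \<phi> X = lim (\<lambda>n. ln (real (card (trajectory G \<phi> X n))) / real n)"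

definition entropy :: "('a, 'b) monoid_scheme \<Rightarrow> ('a \<Rightarrow> 'a) \<Rightarrow> ereal" where
  "entropy G \<phi> = (SUP X \<in> {X. X \<subseteq> carrier G \<and> finite X \<and> X \<noteq> {}}. ereal (entropy_on G \<phi> X))"


section \<open>The Addition Theorem\<close>

text \<open>Endomorphisms of \<open>G\<close> are the elements of \<^term>\<open>hom G G\<close>, automorphisms those of
  \<^term>\<open>iso G G\<close>. Their values outside the carrier are arbitrary and do not affect the entropy.\<close>

definition invariant_under :: "('a \<Rightarrow> 'a) \<Rightarrow> 'a set \<Rightarrow> bool" where
  "invariant_under \<phi> H \<longleftrightarrow> \<phi> ` H \<subseteq> H"

definition stable_under :: "('a, 'b) monoid_scheme \<Rightarrow> ('a \<Rightarrow> 'a) \<Rightarrow> 'a set \<Rightarrow> bool" where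
  "stable_under G \<phi> H \<longleftrightarrow> \<phi> \<in> iso G G \<and> \<phi> ` H = H"

text \<open>The induced map sends the coset \<open>H #> x\<close> to \<open>H #> \<phi> x\<close>. Multiplying the image
  \<open>\<phi> ` (H #> x)\<close> by \<open>H\<close> expresses this without choosing \<open>x\<close>; see \<open>induced_r_coset\<close> below.\<close>

definition induced :: "('a, 'b) monoid_scheme \<Rightarrow> 'a set \<Rightarrow> ('a \<Rightarrow> 'a) \<Rightarrow> 'a set \<Rightarrow> 'a set" where
  "induced G H \<phi> C = H <#>\<^bsub>G\<^esub> \<phi> ` C"

lemma (in group) induced_r_coset:
  assumes "H \<lhd> G" "\<phi> \<in> hom G G" "invariant_under \<phi> H" "x \<in> carrier G"
  shows "induced G H \<phi> (H #> x) = H #> \<phi> x"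
proof -
  interpret H: normal H G by fact
  have mult: "\<phi> (h \<otimes> x) = \<phi> h \<otimes> \<phi> x" if "h \<in> H" for h
    using that assms(2,4) by (simp add: hom_mult H.mem_carrier)
  have in_H: "\<phi> h \<in> H" if "h \<in> H" for h
    using that assms(3) by (auto simp: invariant_under_def)
  have closed: "\<phi> x \<in> carrier G"
    using assms(2,4) by (rule hom_in_carrier)
  show ?thesis
  proof
    show "induced G H \<phi> (H #> x) \<subseteq> H #> \<phi> x"
    proof
      fix y assume "y \<in> induced G H \<phi> (H #> x)"
      then obtain k h where kh: "k \<in> H" "h \<in> H" and "y = k \<otimes> \<phi> (h \<otimes> x)"
        by (auto simp: induced_def set_mult_def r_coset_def)
      then have "y = (k \<otimes> \<phi> h) \<otimes> \<phi> x"
        using closed mult in_H by (simp add: m_assoc H.mem_carrier)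
      then show "y \<in> H #> \<phi> x"
        using kh in_H by (auto simp: r_coset_def)
    qed
    show "H #> \<phi> x \<subseteq> induced G H \<phi> (H #> x)"
    proof
      fix y assume "y \<in> H #> \<phi> x"
      then obtain h where "h \<in> H" "y = h \<otimes> \<phi> x"
        by (auto simp: r_coset_def)
      moreover have "x \<in> H #> x"
        using assms(4) H.subgroup_axioms by (rule rcos_self)
      ultimately show "y \<in> induced G H \<phi> (H #> x)"
        by (auto simp: induced_def set_mult_def)
    qed
  qed
qed

lemma (in group) induced_hom:
  assumes "H \<lhd> G" "\<phi> \<in> hom G G" "invariant_under \<phi> H"
  shows "induced G H \<phi> \<in> hom (G Mod H) (G Mod H)"
proof -
  interpret H: normal H G by fact
  show ?thesis
    using hom_in_carrier[OF assms(2)]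
    by (auto simp: hom_def carrier_FactGroup induced_r_coset[OF assms] H.rcos_sum
        hom_mult[OF assms(2)])
qed

definition AT :: "('a, 'b) monoid_scheme \<Rightarrow> ('a \<Rightarrow> 'a) \<Rightarrow> 'a set \<Rightarrow> bool" where
  "AT G \<phi> H \<longleftrightarrow>
     entropy G \<phi> = entropy (G\<lparr>carrier := H\<rparr>) \<phi> + entropy (G Mod H) (induced G H \<phi>)"


section \<open>Center and nilpotency\<close>

definition center :: "('a, 'b) monoid_scheme \<Rightarrow> 'a set" where
  "center G = {z \<in> carrier G. \<forall>g \<in> carrier G. z \<otimes>\<^bsub>G\<^esub> g = g \<otimes>\<^bsub>G\<^esub> z}"

text \<open>The upper central series: \<open>Z\<^sub>0 = 1\<close>, and \<open>Z\<^sub>n\<^sub>+\<^sub>1\<close> is the preimage in \<open>G\<close> of the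
  center of \<open>G/Z\<^sub>n\<close>.\<close>

primrec upper_central :: "('a, 'b) monoid_scheme \<Rightarrow> nat \<Rightarrow> 'a set" where
  "upper_central G 0 = {\<one>\<^bsub>G\<^esub>}"
| "upper_central G (Suc n) =
     {x \<in> carrier G. upper_central G n #>\<^bsub>G\<^esub> x \<in> center (G Mod upper_central G n)}"

definition nilpotent :: "('a, 'b) monoid_scheme \<Rightarrow> bool" where
  "nilpotent G \<longleftrightarrow> (\<exists>n. upper_central G n = carrier G)"


section \<open>Classes of groups\<close>

text \<open>A class of groups is represented by its members whose elements live in a fixed but
  arbitrary type \<open>'a\<close>. A quotient \<^term>\<open>G Mod N\<close> lives in \<open>'a set\<close>, so closure under quotients
  refers to the groups over \<open>'a\<close> isomorphic to it. Such a copy always exists, by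
  \<open>quotient_copy_exists\<close>. With \<open>N\<close> trivial, closure under quotients includes the usual
  convention that classes of groups are closed under isomorphism.\<close>

definition closed_under_subgroups :: "'a monoid set \<Rightarrow> bool" where
  "closed_under_subgroups \<X> \<longleftrightarrow> (\<forall>G \<in> \<X>. \<forall>H. subgroup H G \<longrightarrow> G\<lparr>carrier := H\<rparr> \<in> \<X>)"

definition closed_under_quotients :: "'a monoid set \<Rightarrow> bool" where
  "closed_under_quotients \<X> \<longleftrightarrow>
     (\<forall>G \<in> \<X>. \<forall>N. N \<lhd> G \<longrightarrow> (\<forall>K. group K \<and> K \<cong> G Mod N \<longrightarrow> K \<in> \<X>))"

lemma quotient_copy_exists:
  fixes G :: "'a monoid"
  assumes "N \<lhd> G"
  shows "\<exists>K :: 'a monoid. group K \<and> K \<cong> G Mod N"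
proof -
  interpret N: normal N G by fact
  interpret Q: group "G Mod N" by (rule N.factorgroup_is_group)
  define r :: "'a set \<Rightarrow> 'a" where "r C = (SOME x. x \<in> C)" for C
  have r: "r C \<in> carrier G" "N #>\<^bsub>G\<^esub> r C = C" if C: "C \<in> carrier (G Mod N)" for C
  proof -
    from C obtain x where x: "x \<in> carrier G" "C = N #>\<^bsub>G\<^esub> x"
      by (auto simp: carrier_FactGroup)
    then have "x \<in> C"
      using N.rcos_self N.is_subgroup by blast
    then have rC: "r C \<in> C"
      unfolding r_def by (rule someI)
    then show "r C \<in> carrier G"
      using x N.r_coset_subset_G N.subset by blast
    show "N #>\<^bsub>G\<^esub> r C = C"
      using N.repr_independence[of "r C" N x] rC x N.is_subgroup by simp
  qed
  have inj: "inj_on r (carrier (G Mod N))"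
    by (metis inj_onI r(2))
  define q where "q = inv_into (carrier (G Mod N)) r"
  define K :: "'a monoid" where
    "K = \<lparr>carrier = r ` carrier (G Mod N), mult = (\<lambda>x y. r (q x \<otimes>\<^bsub>G Mod N\<^esub> q y)),
          one = r \<one>\<^bsub>G Mod N\<^esub>\<rparr>"
  have q: "q (r C) = C" if "C \<in> carrier (G Mod N)" for C
    using that inj by (simp add: q_def)
  have "r \<in> hom (G Mod N) K"
    by (auto simp: hom_def K_def q simp del: mult_FactGroup)
  then have iso: "r \<in> iso (G Mod N) K"
    using inj by (auto simp: iso_def bij_betw_def K_def)
  have "monoid K"
    by (rule monoidI) (auto simp: K_def q Q.m_assoc simp del: mult_FactGroup one_FactGroup)
  moreover have "G Mod N \<cong> K"
    using iso by (rule is_isoI)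
  ultimately show ?thesis
    using Q.iso_imp_group Q.iso_sym by blast
qed

end

theory Submission
  imports Defs "HOL-Algebra.Zassenhaus"
begin

text \<open>Entropy is additive over every \<open>\<phi>\<close>-invariant central subgroup \<open>H\<close>: if \<open>S\<close> is a
  section of the cosets of \<open>H\<close> met by \<open>T\<^sub>m(\<phi>, X)\<close>, then \<open>T\<^sub>m(\<phi>, X) \<subseteq> S W\<close> for some finite
  \<open>W \<subseteq> H\<close>. Multiplying \<open>n\<close> such blocks and moving the central factors to the right gives
  \<open>|T\<^sub>n\<^sub>m(\<phi>, X)| \<le> |S|\<^sup>n |T\<^sub>n\<^sub>m(\<phi>, W)|\<close>, and \<open>ln |S| / m\<close> tends to the growth rate of \<open>X\<close> in \<open>G/H\<close>.

  Write \<open>e(B, A)\<close> for the entropy on \<open>B/A\<close>. In a nilpotent group the central case applies to each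
  step of the series \<open>H \<inter> Z\<^sub>n(G)\<close>. In a solvable group put \<open>D = G'\<close>. The hypothesis for \<open>G\<close>,
  \<open>G/H\<close> and \<open>H\<close>, the abelian case for \<open>G/D\<close> and \<open>H/H'\<close>, the isomorphisms
  \<open>HD/D \<cong> H/(H \<inter> D)\<close> and \<open>HD/H \<cong> D/(H \<inter> D)\<close>, and induction on the derived length for \<open>D\<close> and
  \<open>H \<inter> D\<close> decompose \<open>e(G, 1)\<close> and \<open>e(H, 1) + e(G, H)\<close> into the same summands.\<close>

section \<open>Subadditive sequences\<close>

text \<open>Fekete's lemma. Choose \<open>m\<close> with \<open>a m / m\<close> near the infimum and
  divide with remainder, \<open>n = q * m + r\<close>: subadditivity bounds \<open>a n / n\<close>
  by \<open>a m / m\<close> plus a bounded term divided by \<open>n\<close>.\<close>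

lemma subadditive_quotient_tendsto_Inf:
  fixes a :: "nat \<Rightarrow> real"
  assumes subadd: "\<And>m n. a (m + n) \<le> a m + a n" and nonneg: "\<And>n. 0 \<le> a n"
  shows "(\<lambda>n. a n / n) \<longlonglongrightarrow> (INF n\<in>{1..}. a n / n)"
proof (rule LIMSEQ_I)
  define L where "L = (INF n\<in>{1..}. a n / n)"
  have bdd: "bdd_below ((\<lambda>n. a n / n) ` {1..})"
    by (rule bdd_belowI[of _ 0]) (auto simp: nonneg)
  have L_le: "L \<le> a n / n" if "n \<ge> 1" for n
    unfolding L_def using bdd that by (intro cINF_lower) auto
  fix e :: real assume "0 < e"
  have "\<exists>m\<in>{1..}. a m / m < L + e / 2"
    using \<open>0 < e\<close> cInf_lessD[of "(\<lambda>n. a n / n) ` {1..}" "L + e / 2"]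
    by (auto simp: L_def)
  then obtain m where m: "m \<ge> 1" "a m / m < L + e / 2"
    by auto
  \<comment> \<open>A bound for all remainders \<open>a (n mod m)\<close> at once: a sum of
    nonnegative terms dominates each of them.\<close>
  define C where "C = (\<Sum>r<m. a r)"
  have C: "a r \<le> C" if "r < m" for r
    unfolding C_def using that nonneg by (intro member_le_sum) auto
  have multiple: "a (q * m + r) \<le> q * a m + a r" for q r
  proof (induction q)
    case (Suc q)
    have "a (Suc q * m + r) = a (m + (q * m + r))"
      by (simp add: add.assoc)
    also have "\<dots> \<le> a m + a (q * m + r)"
      by (rule subadd)
    also have "\<dots> \<le> Suc q * a m + a r"
      using Suc by (simp add: algebra_simps)
    finally show ?case .
  qed simp
  have upper: "a n / n \<le> a m / m + C / n" if "n \<ge> 1" for n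
  proof -
    have "a n \<le> real (n div m) * a m + a (n mod m)"
      using multiple[of "n div m" "n mod m"] by simp
    moreover have "a (n mod m) \<le> C"
      using m(1) by (intro C) simp
    moreover have "real (n div m) * a m \<le> n / m * a m"
      using nonneg by (intro mult_right_mono of_nat_div_le_of_nat) auto
    ultimately have "a n \<le> n / m * a m + C"
      by linarith
    then have "a n / n \<le> (n / m * a m + C) / n"
      by (rule divide_right_mono) simp
    also have "\<dots> = a m / m + C / n"
      using that by (simp add: add_divide_distrib)
    finally show ?thesis .
  qed
  \<comment> \<open>Beyond this \<open>N\<close> the remainder term \<open>C / n\<close> is below
    \<open>e / 2\<close>; the other half of \<open>e\<close> was spent on the choice of
    \<open>m\<close>.\<close>
  obtain N where N: "2 * C / e < real N"
    using reals_Archimedean2 by blast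
  have "norm (a n / n - L) < e" if "n \<ge> Suc N" for n
  proof -
    have "2 * C / e < n"
      using that N by linarith
    then have "C / n < e / 2"
      using \<open>0 < e\<close> that by (simp add: field_simps)
    then have "a n / n < L + e"
      using upper[of n] m(2) that by linarith
    then show ?thesis
      using L_le[of n] that by (auto simp: abs_less_iff)
  qed
  then show "\<exists>N. \<forall>n\<ge>N. norm (a n / n - (INF n\<in>{1..}. a n / n)) < e"
    unfolding L_def by blast
qed


section \<open>Relative entropy\<close>

text \<open>For normal \<open>A\<close> this is the size of the image of \<open>S\<close> in the
  quotient by \<open>A\<close>. Counting inside \<open>G\<close> lets entropies of different
  sections be compared without leaving the element type.\<close>

definition coset_card :: "('a, 'b) monoid_scheme \<Rightarrow> 'a set \<Rightarrow> 'a set \<Rightarrow> nat" where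
  "coset_card G A S = card ((\<lambda>x. A #>\<^bsub>G\<^esub> x) ` S)"

definition rel_entropy_on ::
    "('a, 'b) monoid_scheme \<Rightarrow> ('a \<Rightarrow> 'a) \<Rightarrow> 'a set \<Rightarrow> 'a set \<Rightarrow> real" where
  "rel_entropy_on G \<phi> A X = lim (\<lambda>n. ln (real (coset_card G A (trajectory G \<phi> X n))) / real n)"

text \<open>For \<open>\<phi>\<close>-invariant subgroups \<open>B\<close> and \<open>A \<lhd> B\<close> this is the entropy of the endomorphism of
  \<open>B/A\<close> induced by \<open>\<phi>\<close>, expressed inside \<open>G\<close>.\<close>

definition rel_entropy ::
    "('a, 'b) monoid_scheme \<Rightarrow> ('a \<Rightarrow> 'a) \<Rightarrow> 'a set \<Rightarrow> 'a set \<Rightarrow> ereal" where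
  "rel_entropy G \<phi> B A =
     (SUP X \<in> {X. X \<subseteq> B \<and> finite X \<and> X \<noteq> {}}. ereal (rel_entropy_on G \<phi> A X))"

lemma trajectory_carrier_update [simp]:
  "trajectory (G\<lparr>carrier := B\<rparr>) \<phi> X n = trajectory G \<phi> X n"
  by (induction n) auto

text \<open>The formula involves only the multiplication and the unit. Identities proved inside a
  subgroup are thereby identities about \<open>G\<close>.\<close>

lemma rel_entropy_carrier_update [simp]:
  "rel_entropy (G\<lparr>carrier := B\<rparr>) \<phi> C A = rel_entropy G \<phi> C A"
  by (simp add: rel_entropy_def rel_entropy_on_def coset_card_def)

section \<open>Trajectories of an endomorphism\<close>

locale group_endo = group G for G (structure) +
  fixes \<phi>
  assumes endo: "\<phi> \<in> hom G G"
begin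

lemma endo_closed [simp]: "x \<in> carrier G \<Longrightarrow> \<phi> x \<in> carrier G"
  using endo by (rule hom_in_carrier)

lemma funpow_hom: "(\<phi> ^^ n) \<in> hom G G"
proof (induction n)
  case (Suc n)
  then show ?case
    using endo by (auto simp: hom_def Pi_iff)
qed (auto simp: hom_def)

lemma funpow_closed [simp]: "x \<in> carrier G \<Longrightarrow> (\<phi> ^^ n) x \<in> carrier G"
  using funpow_hom by (rule hom_in_carrier)

lemma funpow_image_subset: "X \<subseteq> carrier G \<Longrightarrow> (\<phi> ^^ n) ` X \<subseteq> carrier G"
  by auto

lemma funpow_one [simp]: "(\<phi> ^^ n) \<one> = \<one>"
  using funpow_hom group_axioms by (meson hom_one)

lemma funpow_invariant:
  assumes "invariant_under \<phi> H"
  shows "invariant_under (\<phi> ^^ n) H"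
  using assms by (induction n) (auto simp: invariant_under_def)

lemma funpow_set_mult:
  assumes "S \<subseteq> carrier G" "T \<subseteq> carrier G"
  shows "(\<phi> ^^ n) ` (S <#> T) = ((\<phi> ^^ n) ` S) <#> ((\<phi> ^^ n) ` T)"
  using set_mult_hom[OF funpow_hom assms] .

lemma trajectory_subset_subgroup:
  assumes "subgroup H G" "invariant_under \<phi> H" "X \<subseteq> H"
  shows "trajectory G \<phi> X n \<subseteq> H"
proof (induction n)
  case (Suc n)
  have "(\<phi> ^^ n) ` X \<subseteq> H"
    using funpow_invariant[OF assms(2)] assms(3) by (auto simp: invariant_under_def)
  with Suc show ?case
    using subgroup.m_closed[OF assms(1)] by (auto simp: set_mult_def)
qed (simp add: subgroup.one_closed[OF assms(1)])

lemma trajectory_closed: "X \<subseteq> carrier G \<Longrightarrow> trajectory G \<phi> X n \<subseteq> carrier G"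
  by (rule trajectory_subset_subgroup[OF subgroup_self]) (auto simp: invariant_under_def)

lemma finite_trajectory: "finite X \<Longrightarrow> finite (trajectory G \<phi> X n)"
  by (induction n) (auto simp: set_mult_def)

lemma trajectory_nonempty: "X \<noteq> {} \<Longrightarrow> trajectory G \<phi> X n \<noteq> {}"
  by (induction n) (auto simp: set_mult_def)

text \<open>After the first \<open>m\<close> factors, all remaining ones are images under
  \<open>\<phi> ^^ m\<close>. This gives subadditivity of the logarithmic growth and the
  decomposition into blocks in the central case.\<close>

lemma trajectory_add:
  assumes "X \<subseteq> carrier G"
  shows "trajectory G \<phi> X (m + n) =
    trajectory G \<phi> X m <#> (\<phi> ^^ m) ` trajectory G \<phi> X n"
proof (induction n)
  case 0
  show ?case
    using trajectory_closed[OF assms, of m] by (force simp: set_mult_def)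
next
  case (Suc n)
  have "(\<phi> ^^ (m + n)) ` X = (\<phi> ^^ m) ` (\<phi> ^^ n) ` X"
    by (simp add: funpow_add image_image)
  then show ?case
    using Suc trajectory_closed[OF assms] assms
    by (simp add: funpow_set_mult set_mult_assoc funpow_image_subset)
qed

section \<open>Counting cosets along trajectories\<close>

lemma coset_card_pos:
  assumes "finite S" "S \<noteq> {}"
  shows "0 < coset_card G A S"
  using assms by (auto simp: coset_card_def card_gt_0_iff)

lemma coset_card_one:
  assumes "S \<subseteq> carrier G"
  shows "coset_card G {\<one>} S = card S"
proof -
  have "inj_on (\<lambda>x. {\<one>} #> x) S"
    using assms by (auto simp: inj_on_def r_coset_def subset_iff)
  then show ?thesis
    by (simp add: coset_card_def card_image)
qed

text \<open>By normality the coset of a product is the product of the cosets, so pairs of cosets map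
  onto the cosets met by \<open>S <#> T\<close>.\<close>

lemma coset_card_set_mult_le:
  assumes "A \<lhd> G" "S \<subseteq> carrier G" "T \<subseteq> carrier G" "finite S" "finite T"
  shows "coset_card G A (S <#> T) \<le> coset_card G A S * coset_card G A T"
proof -
  interpret A: normal A G by fact
  have "(\<lambda>x. A #> x) ` (S <#> T) \<subseteq>
      (\<lambda>(C, D). C <#> D) ` ((\<lambda>x. A #> x) ` S \<times> (\<lambda>x. A #> x) ` T)"
  proof
    fix y assume "y \<in> (\<lambda>x. A #> x) ` (S <#> T)"
    then obtain s t where st: "s \<in> S" "t \<in> T" "y = A #> (s \<otimes> t)"
      by (auto simp: set_mult_def)
    then have "y = (A #> s) <#> (A #> t)"
      using assms(2,3) by (simp add: A.rcos_sum subset_iff)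
    with st show "y \<in> (\<lambda>(C, D). C <#> D) ` ((\<lambda>x. A #> x) ` S \<times> (\<lambda>x. A #> x) ` T)"
      by auto
  qed
  then have "card ((\<lambda>x. A #> x) ` (S <#> T)) \<le> card ((\<lambda>x. A #> x) ` S \<times> (\<lambda>x. A #> x) ` T)"
    using assms(4,5) by (intro surj_card_le) auto
  then show ?thesis
    by (simp add: coset_card_def card_cartesian_product)
qed

text \<open>Invariance makes \<open>\<phi> ^^ n\<close> act on cosets, so the cosets met by the
  image of \<open>S\<close> are images of those met by \<open>S\<close>.\<close>

lemma coset_card_funpow_le:
  assumes "A \<lhd> G" "invariant_under \<phi> A" "S \<subseteq> carrier G" "finite S"
  shows "coset_card G A ((\<phi> ^^ n) ` S) \<le> coset_card G A S"
proof -
  have "(\<lambda>x. A #> x) ` (\<phi> ^^ n) ` S = induced G A (\<phi> ^^ n) ` (\<lambda>x. A #> x) ` S"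
    unfolding image_image
  proof (rule image_cong[OF refl])
    fix x assume "x \<in> S"
    then show "A #> (\<phi> ^^ n) x = induced G A (\<phi> ^^ n) (A #> x)"
      using assms(3) induced_r_coset[OF assms(1) funpow_hom funpow_invariant[OF assms(2)], of x n]
      by auto
  qed
  then show ?thesis
    using assms(4) by (simp add: coset_card_def card_image_le)
qed

context
  fixes A X
  assumes A: "A \<lhd> G" "invariant_under \<phi> A"
    and X: "X \<subseteq> carrier G" "finite X" "X \<noteq> {}"
begin

lemma coset_card_trajectory_ge_1: "1 \<le> coset_card G A (trajectory G \<phi> X n)"
  using coset_card_pos[OF finite_trajectory[OF X(2)] trajectory_nonempty[OF X(3)]]
  by (simp add: Suc_leI)

text \<open>\<open>trajectory_add\<close> and the two bounds on coset counts make \<open>c\<close>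
  subadditive, so Fekete's lemma applies. The infimum starts at 1, which keeps the quotient by zero
  out of it.\<close>

lemma rel_entropy_on_Inf:
  defines "c \<equiv> \<lambda>n. ln (real (coset_card G A (trajectory G \<phi> X n)))"
  shows "(\<lambda>n. c n / n) \<longlonglongrightarrow> rel_entropy_on G \<phi> A X"
    and "rel_entropy_on G \<phi> A X = (INF n\<in>{1..}. c n / n)"
proof -
  have ge_1: "1 \<le> real (coset_card G A (trajectory G \<phi> X n))" for n
    using coset_card_trajectory_ge_1[of n] by linarith
  have "c (m + n) \<le> c m + c n" for m n
  proof -
    let ?T = "trajectory G \<phi> X"
    have "coset_card G A (?T (m + n)) \<le> coset_card G A (?T m) * coset_card G A ((\<phi> ^^ m) ` ?T n)"
      unfolding trajectory_add[OF X(1)]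
      using trajectory_closed[OF X(1)] finite_trajectory[OF X(2)]
      by (intro coset_card_set_mult_le A funpow_image_subset finite_imageI)
    also have "\<dots> \<le> coset_card G A (?T m) * coset_card G A (?T n)"
      using trajectory_closed[OF X(1)] finite_trajectory[OF X(2)]
      by (intro mult_le_mono2 coset_card_funpow_le A)
    finally have "c (m + n) \<le> ln (real (coset_card G A (?T m) * coset_card G A (?T n)))"
      unfolding c_def using ge_1[of "m + n"] by (intro ln_mono) (simp_all del: of_nat_mult)
    also have "\<dots> = c m + c n"
      unfolding c_def using ge_1[of m] ge_1[of n] by (simp add: ln_mult)
    finally show ?thesis .
  qed
  moreover have "0 \<le> c n" for n
    unfolding c_def using ge_1 by simp
  ultimately have "(\<lambda>n. c n / n) \<longlonglongrightarrow> (INF n\<in>{1..}. c n / n)"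
    by (rule subadditive_quotient_tendsto_Inf)
  moreover from this have "rel_entropy_on G \<phi> A X = (INF n\<in>{1..}. c n / n)"
    unfolding rel_entropy_on_def c_def by (rule limI)
  ultimately show "(\<lambda>n. c n / n) \<longlonglongrightarrow> rel_entropy_on G \<phi> A X"
    and "rel_entropy_on G \<phi> A X = (INF n\<in>{1..}. c n / n)"
    by simp_all
qed

lemma rel_entropy_on_nonneg: "0 \<le> rel_entropy_on G \<phi> A X"
proof -
  have "0 \<le> ln (real (coset_card G A (trajectory G \<phi> X n))) / n" for n
    using coset_card_trajectory_ge_1[of n] by simp
  then show ?thesis
    using rel_entropy_on_Inf(1) by (intro LIMSEQ_le_const) auto
qed

end

end


section \<open>Central subgroups\<close>

context group_endo
begin

lemma rel_entropy_upper:
  assumes "X \<subseteq> B" "finite X" "X \<noteq> {}"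
  shows "ereal (rel_entropy_on G \<phi> A X) \<le> rel_entropy G \<phi> B A"
  unfolding rel_entropy_def using assms by (intro SUP_upper) auto

text \<open>The singleton of the unit bounds the supremum from below. This excludes the value minus
  infinity in the sums of extended reals below.\<close>

lemma rel_entropy_nonneg:
  assumes "A \<lhd> G" "invariant_under \<phi> A" "subgroup B G"
  shows "0 \<le> rel_entropy G \<phi> B A"
proof -
  have "\<one> \<in> B"
    using assms(3) by (rule subgroup.one_closed)
  then have "ereal (rel_entropy_on G \<phi> A {\<one>}) \<le> rel_entropy G \<phi> B A"
    by (intro rel_entropy_upper) auto
  moreover have "0 \<le> rel_entropy_on G \<phi> A {\<one>}"
    using assms(1,2) by (intro rel_entropy_on_nonneg) auto
  ultimately show ?thesis
    by (meson dual_order.trans ereal_less_eq(5))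
qed

lemma one_invariant: "invariant_under \<phi> {\<one>}"
  using funpow_one[of 1] by (simp add: invariant_under_def)

lemma card_set_mult_le:
  assumes "S \<subseteq> carrier G" "T \<subseteq> carrier G" "finite S" "finite T"
  shows "card (S <#> T) \<le> card S * card T"
  using coset_card_set_mult_le[OF one_is_normal assms] assms setmult_subset_G[OF assms(1,2)]
  by (simp add: coset_card_one)

text \<open>An element of \<open>X\<close> is padded with units in the remaining
  \<open>m - 1\<close> factors. This later enlarges a single \<open>W\<close> to a whole block of
  its trajectory.\<close>

lemma mono_trajectory_one:
  assumes "X \<subseteq> carrier G" "\<one> \<in> X" "1 \<le> m"
  shows "X \<subseteq> trajectory G \<phi> X m"
proof
  fix x assume x: "x \<in> X"
  have "\<one> \<in> trajectory G \<phi> X k" for k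
  proof (induction k)
    case (Suc k)
    moreover have "\<one> \<in> (\<phi> ^^ k) ` X"
      using assms(2) funpow_one by (metis image_eqI)
    ultimately have "\<one> \<otimes> \<one> \<in> trajectory G \<phi> X (Suc k)"
      unfolding trajectory.simps set_mult_def by blast
    then show ?case
      by simp
  qed simp
  then have "\<one> \<in> (\<phi> ^^ 1) ` trajectory G \<phi> X (m - 1)"
    using funpow_one by (metis image_eqI)
  moreover have "trajectory G \<phi> X m = X <#> (\<phi> ^^ 1) ` trajectory G \<phi> X (m - 1)"
    using trajectory_add[OF assms(1), of 1 "m - 1"] assms(3) trajectory_1[OF assms(1)] by simp
  ultimately have "x \<otimes> \<one> \<in> trajectory G \<phi> X m"
    using x unfolding set_mult_def by blast
  then show "x \<in> trajectory G \<phi> X m"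
    using x assms(1) by auto
qed

lemma central_set_mult_commute:
  assumes "S \<subseteq> carrier G" "W \<subseteq> center G"
  shows "W <#> S = S <#> W"
proof -
  have "w \<otimes> s = s \<otimes> w" if "w \<in> W" "s \<in> S" for w s
    using that assms by (auto simp: center_def)
  then have "W <#> S = (\<Union>w\<in>W. \<Union>s\<in>S. {s \<otimes> w})"
    unfolding set_mult_def by (intro SUP_cong refl) simp
  also have "\<dots> = S <#> W"
    unfolding set_mult_def by blast
  finally show ?thesis .
qed

lemma central_imp_normal:
  assumes "subgroup H G" "H \<subseteq> center G"
  shows "H \<lhd> G"
proof (rule normal_invI[OF assms(1)])
  fix x h assume xh: "x \<in> carrier G" "h \<in> H"
  then have "h \<otimes> x = x \<otimes> h" "h \<in> carrier G"
    using assms(2) by (auto simp: center_def)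
  then have "x \<otimes> h \<otimes> inv x = h"
    using xh(1) by (metis inv_solve_right m_closed)
  with xh(2) show "x \<otimes> h \<otimes> inv x \<in> H"
    by simp
qed

text \<open>One element of \<open>T\<close> is chosen in each coset that \<open>T\<close> meets.
  Both inequalities of the central case count through such representatives.\<close>

lemma coset_section:
  assumes "subgroup H G" "T \<subseteq> carrier G" "finite T"
  obtains S where "S \<subseteq> T" "card S = coset_card G H T" "inj_on (\<lambda>x. H #> x) S"
    "(\<lambda>x. H #> x) ` S = (\<lambda>x. H #> x) ` T"
proof -
  obtain S where S: "S \<subseteq> T" "inj_on (\<lambda>x. H #> x) S" "(\<lambda>x. H #> x) ` T = (\<lambda>x. H #> x) ` S"
    using subset_image_inj[of "(\<lambda>x. H #> x) ` T" "\<lambda>x. H #> x" T] by auto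
  then show thesis
    using that by (simp add: coset_card_def card_image)
qed

context
  fixes H
  assumes H: "subgroup H G" "H \<subseteq> center G" "invariant_under \<phi> H"
begin

lemma central_subset: "H \<subseteq> carrier G"
  using H(1) by (rule subgroup.subset)

text \<open>Only finitely many central corrections are needed to write one block of length
  \<open>m\<close> through coset representatives. They do not depend on \<open>n\<close>, because
  later blocks are images of the first under powers of \<open>\<phi> ^^ m\<close>.\<close>

lemma card_trajectory_central_le:
  assumes X: "X \<subseteq> carrier G" "finite X" "X \<noteq> {}" and m: "1 \<le> m"
  obtains W where "W \<subseteq> H" "finite W" "W \<noteq> {}"
    "\<And>n. card (trajectory G \<phi> X (n * m)) \<le>
      coset_card G H (trajectory G \<phi> X m) ^ n * card (trajectory G \<phi> W (n * m))"
proof -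
  let ?T = "trajectory G \<phi> X m"
  note T = trajectory_closed[OF X(1), of m] finite_trajectory[OF X(2), of m]
    trajectory_nonempty[OF X(3), of m]
  obtain S where S: "S \<subseteq> ?T" "card S = coset_card G H ?T" "(\<lambda>x. H #> x) ` S = (\<lambda>x. H #> x) ` ?T"
    using coset_section[OF H(1) T(1,2)] by metis
  then have S_closed: "S \<subseteq> carrier G" and S_finite: "finite S"
    using T by (auto intro: finite_subset)
  \<comment> \<open>The elements of \<open>H\<close> by which two members of the block differ. Each
    is \<open>inv s \<otimes> t\<close> for a pair in the finite block, hence finiteness; taking
    equal members puts the unit into \<open>W\<close>.\<close>
  define W where "W = {w \<in> H. \<exists>s\<in>?T. s \<otimes> w \<in> ?T}"
  have WH: "W \<subseteq> H"
    by (auto simp: W_def)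
  then have W: "W \<subseteq> center G" "W \<subseteq> carrier G"
    using H(2) central_subset by auto
  have "W \<subseteq> (\<lambda>(s, t). inv s \<otimes> t) ` (?T \<times> ?T)"
  proof
    fix w assume "w \<in> W"
    then obtain s where s: "s \<in> ?T" "s \<otimes> w \<in> ?T" "w \<in> carrier G"
      using W(2) by (auto simp: W_def)
    then have "w = inv s \<otimes> (s \<otimes> w)"
      using T(1) by (simp add: m_assoc[symmetric] subset_iff)
    with s show "w \<in> (\<lambda>(s, t). inv s \<otimes> t) ` (?T \<times> ?T)"
      by (intro image_eqI[of _ _ "(s, s \<otimes> w)"]) auto
  qed
  then have W_finite: "finite W"
    using T(2) by (auto intro: finite_subset)
  have W_one: "\<one> \<in> W"
    unfolding W_def using T(1,3) subgroup.one_closed[OF H(1)] by force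
  have T_subset: "?T \<subseteq> S <#> W"
  proof
    fix t assume t: "t \<in> ?T"
    then obtain s where s: "s \<in> S" "H #> t = H #> s"
      using S(3) by (metis imageE image_eqI)
    have "t \<in> H #> s"
      using t s(2) T(1) H(1) by (metis rcos_self subsetD)
    then obtain h where h: "h \<in> H" "t = h \<otimes> s"
      by (auto simp: r_coset_def)
    then have "t = s \<otimes> h"
      using H(2) S_closed s(1) by (auto simp: center_def)
    moreover have "h \<in> W"
      using h(1) t s(1) S(1) \<open>t = s \<otimes> h\<close> by (auto simp: W_def)
    ultimately show "t \<in> S <#> W"
      using s(1) by (auto simp: set_mult_def)
  qed
  note WT = trajectory_closed[OF W(2)]
  \<comment> \<open>\<open>P\<close> collects the noncentral factors: it is the product of the
    images of \<open>S\<close> under \<open>\<phi> ^^ (k * m)\<close> for \<open>k < n\<close>,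
    hence the bound \<open>card S ^ n\<close>.\<close>
  have cover: "\<exists>P. P \<subseteq> carrier G \<and> finite P \<and> card P \<le> card S ^ n \<and>
      trajectory G \<phi> X (n * m) \<subseteq> P <#> trajectory G \<phi> W (n * m)" for n
  proof (induction n)
    case 0
    show ?case
      by (rule exI[of _ "{\<one>}"]) (auto simp: set_mult_def)
  next
    case (Suc n)
    then obtain P where P: "P \<subseteq> carrier G" "finite P" "card P \<le> card S ^ n"
      "trajectory G \<phi> X (n * m) \<subseteq> P <#> trajectory G \<phi> W (n * m)"
      by auto
    let ?P = "(\<phi> ^^ m) ` P" and ?V = "(\<phi> ^^ m) ` trajectory G \<phi> W (n * m)"
    note PV = funpow_image_subset[OF P(1), of m] funpow_image_subset[OF WT[of "n * m"], of m]
    have "trajectory G \<phi> X (Suc n * m) = ?T <#> (\<phi> ^^ m) ` trajectory G \<phi> X (n * m)"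
      using trajectory_add[OF X(1), of m "n * m"] by simp
    also have "\<dots> \<subseteq> (S <#> W) <#> (\<phi> ^^ m) ` (P <#> trajectory G \<phi> W (n * m))"
      by (intro mono_set_mult T_subset image_mono P(4))
    also have "\<dots> = (S <#> W) <#> (?P <#> ?V)"
      by (simp add: funpow_set_mult P(1) WT)
    also have "\<dots> = S <#> ((W <#> ?P) <#> ?V)"
      using S_closed W(2) PV by (simp add: set_mult_assoc set_mult_closed)
    \<comment> \<open>Centrality lets the corrections of the first block pass to the right of the
      representatives of the later blocks.\<close>
    also have "W <#> ?P = ?P <#> W"
      using PV(1) W(1) by (rule central_set_mult_commute)
    also have "S <#> ((?P <#> W) <#> ?V) = (S <#> ?P) <#> (W <#> ?V)"
      using S_closed W(2) PV by (simp add: set_mult_assoc set_mult_closed)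
    \<comment> \<open>Replacing \<open>W\<close> by its trajectory of length \<open>m\<close> makes
      the central factors fit together to the trajectory of length \<open>Suc n * m\<close>.\<close>
    also have "\<dots> \<subseteq> (S <#> ?P) <#> (trajectory G \<phi> W m <#> ?V)"
      by (intro mono_set_mult mono_trajectory_one order_refl W(2) W_one m)
    also have "\<dots> = (S <#> ?P) <#> trajectory G \<phi> W (Suc n * m)"
      using trajectory_add[OF W(2), of m "n * m"] by simp
    finally have "trajectory G \<phi> X (Suc n * m) \<subseteq> (S <#> ?P) <#> trajectory G \<phi> W (Suc n * m)" .
    moreover have "card (S <#> ?P) \<le> card S ^ Suc n"
    proof -
      have "card (S <#> ?P) \<le> card S * card ?P"
        using S_closed S_finite PV(1) P(2) by (intro card_set_mult_le) auto
      also have "\<dots> \<le> card S * card S ^ n"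
        using card_image_le[OF P(2), of "\<phi> ^^ m"] P(3) by (intro mult_le_mono2) simp
      finally show ?thesis
        by simp
    qed
    moreover have "finite (S <#> ?P)"
      using S_finite P(2) by (auto simp: set_mult_def)
    ultimately show ?case
      using set_mult_closed[OF S_closed PV(1)] by blast
  qed
  have card_le: "card (trajectory G \<phi> X (n * m)) \<le> card S ^ n * card (trajectory G \<phi> W (n * m))"
    for n
  proof -
    obtain P where P: "P \<subseteq> carrier G" "finite P" "card P \<le> card S ^ n"
      "trajectory G \<phi> X (n * m) \<subseteq> P <#> trajectory G \<phi> W (n * m)"
      using cover[of n] by blast
    have "card (trajectory G \<phi> X (n * m)) \<le> card (P <#> trajectory G \<phi> W (n * m))"
      using P finite_trajectory[OF W_finite] by (intro card_mono) (auto simp: set_mult_def)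
    also have "\<dots> \<le> card P * card (trajectory G \<phi> W (n * m))"
      using P WT finite_trajectory[OF W_finite] by (intro card_set_mult_le)
    also have "\<dots> \<le> card S ^ n * card (trajectory G \<phi> W (n * m))"
      using P(3) by (intro mult_le_mono1)
    finally show ?thesis .
  qed
  show thesis
    using that[OF WH W_finite] W_one card_le S(2) by auto
qed

text \<open>Logarithms of the block estimate are divided by \<open>n * m\<close>, and
  \<open>n\<close> tends to infinity for fixed \<open>m\<close>. Since \<open>W\<close> depends on
  \<open>m\<close>, its growth rate is replaced by the supremum over \<open>H\<close> before
  \<open>m\<close> tends to infinity.\<close>

lemma rel_entropy_on_le_central:
  assumes X: "X \<subseteq> carrier G" "finite X" "X \<noteq> {}"
  shows "ereal (rel_entropy_on G \<phi> {\<one>} X) \<le>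
    rel_entropy G \<phi> H {\<one>} + ereal (rel_entropy_on G \<phi> H X)"
proof -
  note HN = central_imp_normal[OF H(1,2)]
  define s where "s m = ln (real (coset_card G H (trajectory G \<phi> X m)))" for m
  have step: "ereal (rel_entropy_on G \<phi> {\<one>} X) \<le> rel_entropy G \<phi> H {\<one>} + ereal (s m / m)"
    if m: "1 \<le> m" for m
  proof -
    obtain W where W: "W \<subseteq> H" "finite W" "W \<noteq> {}"
      and card_le: "\<And>n. card (trajectory G \<phi> X (n * m)) \<le>
        coset_card G H (trajectory G \<phi> X m) ^ n * card (trajectory G \<phi> W (n * m))"
      using card_trajectory_central_le[OF X m] by metis
    have WG: "W \<subseteq> carrier G"
      using W(1) central_subset by auto
    define c where "c Y n = ln (real (coset_card G {\<one>} (trajectory G \<phi> Y n)))" for Y n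
    have c_eq: "c Y n = ln (real (card (trajectory G \<phi> Y n)))" if "Y \<subseteq> carrier G" for Y n
      using that by (simp add: c_def coset_card_one trajectory_closed)
    \<comment> \<open>The block estimate concerns multiples of \<open>m\<close> only; along this
      subsequence the limit is the same.\<close>
    have sub: "(\<lambda>n. c Y (n * m) / real (n * m)) \<longlonglongrightarrow> rel_entropy_on G \<phi> {\<one>} Y"
      if "Y \<subseteq> carrier G" "finite Y" "Y \<noteq> {}" for Y
      unfolding c_def
      using LIMSEQ_subseq_LIMSEQ[OF rel_entropy_on_Inf(1)[OF one_is_normal one_invariant that],
          of "\<lambda>n. n * m"] m
      by (simp add: o_def strict_mono_def)
    have "rel_entropy_on G \<phi> {\<one>} X \<le> rel_entropy_on G \<phi> {\<one>} W + s m / m"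
    proof (rule LIMSEQ_le[OF sub[OF X] tendsto_add[OF sub[OF WG W(2,3)] tendsto_const]],
        intro exI[of _ 1] allI impI)
      fix n :: nat assume n: "1 \<le> n"
      have pos: "0 < card (trajectory G \<phi> Y k)" if "finite Y" "Y \<noteq> {}" for Y k
        using that by (simp add: card_gt_0_iff finite_trajectory trajectory_nonempty)
      have pos': "0 < coset_card G H (trajectory G \<phi> X m)"
        using X by (intro coset_card_pos finite_trajectory trajectory_nonempty)
      have "c X (n * m) \<le> ln (real (coset_card G H (trajectory G \<phi> X m) ^ n *
          card (trajectory G \<phi> W (n * m))))"
        unfolding c_eq[OF X(1)] using card_le[of n] pos[OF X(2,3), of "n * m"]
        by (intro ln_mono) (simp_all only: of_nat_le_iff of_nat_0_less_iff)
      also have "\<dots> = n * s m + c W (n * m)"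
        unfolding c_eq[OF WG] s_def using pos[OF W(2,3), of "n * m"] pos'
        by (simp add: ln_mult ln_realpow)
      finally have "c X (n * m) / real (n * m) \<le> (n * s m + c W (n * m)) / real (n * m)"
        by (rule divide_right_mono) simp
      also have "\<dots> = c W (n * m) / real (n * m) + s m / m"
        using n m by (simp add: add_divide_distrib)
      finally show "c X (n * m) / real (n * m) \<le> c W (n * m) / real (n * m) + s m / m" .
    qed
    then have "ereal (rel_entropy_on G \<phi> {\<one>} X) \<le>
        ereal (rel_entropy_on G \<phi> {\<one>} W) + ereal (s m / m)"
      by simp
    also have "\<dots> \<le> rel_entropy G \<phi> H {\<one>} + ereal (s m / m)"
      using W by (intro add_right_mono rel_entropy_upper)
    finally show ?thesis .
  qed
  show ?thesis
  \<comment> \<open>A finite entropy on \<open>H\<close> allows the limit in \<open>m\<close> to be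
    taken in the reals. The infinite value makes the bound trivial, and minus infinity contradicts
    nonnegativity.\<close>
  proof (cases "rel_entropy G \<phi> H {\<one>}")
    case (real r)
    have "rel_entropy_on G \<phi> {\<one>} X \<le> r + rel_entropy_on G \<phi> H X"
    proof (rule LIMSEQ_le_const[OF tendsto_add[OF tendsto_const]])
      show "(\<lambda>m. s m / m) \<longlonglongrightarrow> rel_entropy_on G \<phi> H X"
        unfolding s_def by (rule rel_entropy_on_Inf(1)[OF HN H(3) X])
      show "\<exists>N. \<forall>m\<ge>N. rel_entropy_on G \<phi> {\<one>} X \<le> r + s m / m"
        using step real by auto
    qed
    then show ?thesis
      using real by simp
  next
    case MInf
    then show ?thesis
      using rel_entropy_nonneg[OF one_is_normal one_invariant H(1)] by simp
  qed simp
qed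

text \<open>Centrality splits the trajectory of \<open>X <#> Y\<close> into those of
  \<open>X\<close> and \<open>Y\<close>. Coset representatives from the first multiply injectively
  with the second, which lies in \<open>H\<close>, so the counts multiply.\<close>

lemma rel_entropy_on_ge_central:
  assumes X: "X \<subseteq> carrier G" "finite X" "X \<noteq> {}" and Y: "Y \<subseteq> H" "finite Y" "Y \<noteq> {}"
  shows "rel_entropy_on G \<phi> {\<one>} Y + rel_entropy_on G \<phi> H X \<le>
    rel_entropy_on G \<phi> {\<one>} (X <#> Y)"
proof -
  note HN = central_imp_normal[OF H(1,2)]
  have YG: "Y \<subseteq> carrier G"
    using Y(1) central_subset by auto
  have XY: "X <#> Y \<subseteq> carrier G" "finite (X <#> Y)" "X <#> Y \<noteq> {}"
    using X Y YG by (auto simp: set_mult_def)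
  let ?T = "trajectory G \<phi>"
  have YH: "?T Y n \<subseteq> H" for n
    by (rule trajectory_subset_subgroup[OF H(1,3) Y(1)])
  have split: "?T (X <#> Y) n = ?T X n <#> ?T Y n" for n
  proof (induction n)
    case 0
    show ?case
      by (simp add: set_mult_def)
  next
    case (Suc n)
    let ?X = "(\<phi> ^^ n) ` X" and ?Y = "(\<phi> ^^ n) ` Y"
    note closed = trajectory_closed[OF X(1), of n] trajectory_closed[OF YG, of n]
      funpow_image_subset[OF X(1), of n] funpow_image_subset[OF YG, of n]
    have "?T (X <#> Y) (Suc n) = (?T X n <#> ?T Y n) <#> (?X <#> ?Y)"
      using Suc by (simp add: funpow_set_mult X(1) YG)
    also have "\<dots> = ?T X n <#> ((?T Y n <#> ?X) <#> ?Y)"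
      using closed by (simp add: set_mult_assoc set_mult_closed)
    also have "?T Y n <#> ?X = ?X <#> ?T Y n"
      using YH[of n] H(2) closed by (intro central_set_mult_commute) auto
    also have "?T X n <#> ((?X <#> ?T Y n) <#> ?Y) = (?T X n <#> ?X) <#> (?T Y n <#> ?Y)"
      using closed by (simp add: set_mult_assoc set_mult_closed)
    finally show ?case
      by simp
  qed
  have card_le: "coset_card G {\<one>} (?T Y n) * coset_card G H (?T X n) \<le>
      coset_card G {\<one>} (?T (X <#> Y) n)" for n
  proof -
    obtain S where S: "S \<subseteq> ?T X n" "card S = coset_card G H (?T X n)" "inj_on (\<lambda>x. H #> x) S"
      using coset_section[OF H(1) trajectory_closed[OF X(1)] finite_trajectory[OF X(2)]] by metis
    have SG: "S \<subseteq> carrier G"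
      using S(1) trajectory_closed[OF X(1)] by blast
    have "inj_on (\<lambda>(y, x). x \<otimes> y) (?T Y n \<times> S)"
    proof (rule inj_onI, clarify)
      fix y x y' x'
      assume y: "y \<in> ?T Y n" and y': "y' \<in> ?T Y n" and x: "x \<in> S" and x': "x' \<in> S"
        and eq: "x \<otimes> y = x' \<otimes> y'"
      \<comment> \<open>The coset of a product determines the representative; cancellation then
        recovers the factor in \<open>H\<close>.\<close>
      have coset: "H #> (b \<otimes> a) = H #> b" if "a \<in> ?T Y n" "b \<in> S" for a b
      proof -
        have "a \<in> H" "b \<in> carrier G"
          using that YH SG by auto
        then have "b \<otimes> a = a \<otimes> b"
          using H(2) by (auto simp: center_def)
        moreover have "H #> (a \<otimes> b) = H #> b"
          using \<open>a \<in> H\<close> \<open>b \<in> carrier G\<close> H(1) central_subset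
            coset_mult_assoc[of H a b] coset_join2[of a H] by auto
        ultimately show ?thesis
          by simp
      qed
      have "H #> x = H #> x'"
        using coset[OF y x] coset[OF y' x'] eq by simp
      then have "x = x'"
        using S(3) x x' by (auto dest: inj_onD)
      moreover have "y \<in> carrier G" "y' \<in> carrier G" "x \<in> carrier G"
        using y y' x SG YH central_subset by blast+
      ultimately show "y = y' \<and> x = x'"
        using eq by simp
    qed
    moreover have "(\<lambda>(y, x). x \<otimes> y) ` (?T Y n \<times> S) \<subseteq> ?T (X <#> Y) n"
      unfolding split using S(1) by (auto simp: set_mult_def)
    ultimately have "card (?T Y n \<times> S) \<le> card (?T (X <#> Y) n)"
      using card_inj_on_le finite_trajectory[OF XY(2)] by blast
    then show ?thesis
      using S(2) by (simp add: coset_card_one trajectory_closed YG XY(1) card_cartesian_product)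
  qed
  note lims = rel_entropy_on_Inf(1)[OF one_is_normal one_invariant YG Y(2,3)]
    rel_entropy_on_Inf(1)[OF HN H(3) X] rel_entropy_on_Inf(1)[OF one_is_normal one_invariant XY]
  show ?thesis
  proof (rule LIMSEQ_le[OF tendsto_add[OF lims(1,2)] lims(3)], intro exI allI impI)
    fix n :: nat
    have pos: "0 < coset_card G A (?T Z n)" if "finite Z" "Z \<noteq> {}" for A Z
      using that by (intro coset_card_pos finite_trajectory trajectory_nonempty)
    have "ln (real (coset_card G {\<one>} (?T Y n))) + ln (real (coset_card G H (?T X n))) =
        ln (real (coset_card G {\<one>} (?T Y n) * coset_card G H (?T X n)))"
      using pos[OF X(2,3)] pos[OF Y(2,3)] by (simp add: ln_mult)
    also have "\<dots> \<le> ln (real (coset_card G {\<one>} (?T (X <#> Y) n)))"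
      using card_le[of n] pos[OF X(2,3)] pos[OF Y(2,3)]
      by (intro ln_mono) (simp_all only: of_nat_le_iff of_nat_0_less_iff mult_pos_pos)
    finally show "ln (real (coset_card G {\<one>} (?T Y n))) / n +
        ln (real (coset_card G H (?T X n))) / n \<le>
        ln (real (coset_card G {\<one>} (?T (X <#> Y) n))) / n"
      by (simp add: add_divide_distrib[symmetric] divide_right_mono)
  qed
qed

theorem rel_entropy_add_central:
  "rel_entropy G \<phi> (carrier G) {\<one>} =
    rel_entropy G \<phi> H {\<one>} + rel_entropy G \<phi> (carrier G) H"
proof (rule antisym)
  show "rel_entropy G \<phi> (carrier G) {\<one>} \<le>
    rel_entropy G \<phi> H {\<one>} + rel_entropy G \<phi> (carrier G) H"
    unfolding rel_entropy_def[of G \<phi> "carrier G" "{\<one>}"]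
  proof (rule SUP_least, clarify)
    fix X assume X: "X \<subseteq> carrier G" "finite X" "X \<noteq> {}"
    show "ereal (rel_entropy_on G \<phi> {\<one>} X) \<le>
        rel_entropy G \<phi> H {\<one>} + rel_entropy G \<phi> (carrier G) H"
      using rel_entropy_on_le_central[OF X] add_left_mono[OF rel_entropy_upper[OF X, of H]]
      by (rule order_trans)
  qed
  let ?I = "{X. X \<subseteq> carrier G \<and> finite X \<and> X \<noteq> {}}" and ?J = "{X. X \<subseteq> H \<and> finite X \<and> X \<noteq> {}}"
  have ne: "?I \<noteq> {}" "?J \<noteq> {}"
    using subgroup.one_closed[OF H(1)] by (auto intro: exI[of _ "{\<one>}"])
  have bound: "ereal (rel_entropy_on G \<phi> {\<one>} Y) + ereal (rel_entropy_on G \<phi> H X) \<le>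
      rel_entropy G \<phi> (carrier G) {\<one>}" if "X \<in> ?I" "Y \<in> ?J" for X Y
  proof -
    have "X <#> Y \<subseteq> carrier G" "finite (X <#> Y)" "X <#> Y \<noteq> {}"
      using that central_subset by (auto simp: set_mult_def)
    then have "ereal (rel_entropy_on G \<phi> {\<one>} (X <#> Y)) \<le> rel_entropy G \<phi> (carrier G) {\<one>}"
      by (rule rel_entropy_upper)
    moreover have "ereal (rel_entropy_on G \<phi> {\<one>} Y) + ereal (rel_entropy_on G \<phi> H X) \<le>
        ereal (rel_entropy_on G \<phi> {\<one>} (X <#> Y))"
      using rel_entropy_on_ge_central[of X Y] that by simp
    ultimately show ?thesis
      by (rule order_trans[rotated])
  qed
  \<comment> \<open>The supremum is taken over \<open>Y\<close> for fixed \<open>X\<close>, then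
    over \<open>X\<close>. Moving a constant out of it requires a nonempty index set and a constant
    other than minus infinity.\<close>
  have "rel_entropy G \<phi> H {\<one>} + ereal (rel_entropy_on G \<phi> H X) \<le>
      rel_entropy G \<phi> (carrier G) {\<one>}" if "X \<in> ?I" for X
    unfolding rel_entropy_def[of G \<phi> H]
    using bound[OF that]
    by (subst SUP_ereal_add_left[symmetric, OF ne(2)]) (simp, intro SUP_least)
  then show "rel_entropy G \<phi> H {\<one>} + rel_entropy G \<phi> (carrier G) H \<le>
      rel_entropy G \<phi> (carrier G) {\<one>}"
    unfolding rel_entropy_def[of G \<phi> "carrier G" H]
    using rel_entropy_nonneg[OF one_is_normal one_invariant H(1)]
    by (subst SUP_ereal_add_right[symmetric, OF ne(1)]) (force, intro SUP_least)
qed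

end

end


section \<open>Transfer along homomorphisms\<close>

text \<open>\<open>h\<close> maps trajectories onto trajectories. Since its kernel within
  \<open>B\<close> lies in \<open>A\<close>, it separates the cosets of \<open>A\<close> in
  \<open>B\<close>, so every coset count is preserved.\<close>

lemma (in group_hom) rel_entropy_hom_image:
  assumes inv: "invariant_under \<phi> B" and intertwine: "\<And>x. x \<in> B \<Longrightarrow> h (\<phi> x) = \<psi> (h x)"
    and B: "subgroup B G" and A: "subgroup A G" "A \<subseteq> B"
    and ker: "\<And>x. x \<in> B \<Longrightarrow> h x = \<one>\<^bsub>H\<^esub> \<Longrightarrow> x \<in> A"
  shows "rel_entropy H \<psi> (h ` B) (h ` A) = rel_entropy G \<phi> B A"
proof -
  have BG: "B \<subseteq> carrier G"
    using B by (rule subgroup.subset)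
  have funpow: "(\<phi> ^^ n) x \<in> B \<and> h ((\<phi> ^^ n) x) = (\<psi> ^^ n) (h x)" if "x \<in> B" for n x
    using that inv intertwine by (induction n) (auto simp: invariant_under_def)
  have traj: "trajectory G \<phi> X n \<subseteq> B \<and> trajectory H \<psi> (h ` X) n = h ` trajectory G \<phi> X n"
    if X: "X \<subseteq> B" for X n
  proof (induction n)
    case 0
    show ?case
      using subgroup.one_closed[OF B] by simp
  next
    case (Suc n)
    have sub: "(\<phi> ^^ n) ` X \<subseteq> B"
      using funpow X by auto
    have "(\<psi> ^^ n) ` h ` X = h ` (\<phi> ^^ n) ` X"
      unfolding image_image using funpow X by (intro image_cong) auto
    then have "trajectory H \<psi> (h ` X) (Suc n) = h ` trajectory G \<phi> X (Suc n)"
      using Suc set_mult_hom[OF homh subset_trans[OF _ BG] subset_trans[OF sub BG]] by simp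
    moreover have "trajectory G \<phi> X (Suc n) \<subseteq> B"
      using Suc sub subgroup.m_closed[OF B] by (auto simp: set_mult_def)
    ultimately show ?case
      by simp
  qed
  have card: "coset_card H (h ` A) (h ` T) = coset_card G A T" if T: "T \<subseteq> B" for T
  proof -
    have "h ` A #>\<^bsub>H\<^esub> h x = h ` (A #> x)" if "x \<in> B" for x
      unfolding r_coset_eq_set_mult
      using that BG A(2) set_mult_hom[OF homh, of A "{x}"] by auto
    then have "(\<lambda>y. h ` A #>\<^bsub>H\<^esub> y) ` h ` T = (`) h ` (\<lambda>x. A #> x) ` T"
      unfolding image_image using T by (intro image_cong) auto
    \<comment> \<open>Equal image cosets give \<open>h x = h (a \<otimes> y)\<close> with
      \<open>a\<close> in \<open>A\<close>; the quotient of the two arguments is in the kernel,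
      hence in \<open>A\<close>.\<close>
    moreover have "inj_on ((`) h) ((\<lambda>x. A #> x) ` T)"
    proof (rule inj_onI, clarify)
      fix x y assume xy: "x \<in> T" "y \<in> T" and eq: "h ` (A #> x) = h ` (A #> y)"
      then have xyB: "x \<in> B" "y \<in> B"
        using T by auto
      then have "h x \<in> h ` (A #> x)"
        using BG A(1) G.rcos_self[of x A] by auto
      then obtain a where a: "a \<in> A" "h x = h (a \<otimes> y)"
        unfolding eq by (auto simp: r_coset_def)
      have ay: "a \<otimes> y \<in> B"
        using a(1) A(2) xyB(2) subgroup.m_closed[OF B] by auto
      have "x \<otimes> inv (a \<otimes> y) \<in> B"
        using xyB(1) ay B by (simp add: subgroup.m_closed subgroup.m_inv_closed)
      moreover have "h (x \<otimes> inv (a \<otimes> y)) = \<one>\<^bsub>H\<^esub>"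
        using xyB(1) ay BG a(2) by (simp add: subset_iff)
      ultimately have "x \<otimes> inv (a \<otimes> y) \<in> A"
        by (rule ker)
      then have "x \<in> A #> (a \<otimes> y)"
        using A(1) xyB(1) ay BG by (intro subgroup.rcos_module_rev) auto
      moreover have "A #> (a \<otimes> y) = A #> y"
        using a(1) A xyB(2) BG G.coset_mult_assoc[of A a y] G.coset_join2[of a A] by auto
      ultimately show "A #> x = A #> y"
        using G.repr_independence[of x A y] xyB(2) BG A(1) by auto
    qed
    ultimately show ?thesis
      by (simp add: coset_card_def card_image)
  qed
  have on: "rel_entropy_on H \<psi> (h ` A) (h ` X) = rel_entropy_on G \<phi> A X" if "X \<subseteq> B" for X
    using traj[OF that] card by (simp add: rel_entropy_on_def)
  \<comment> \<open>Finite subsets of the image lift to finite subsets of \<open>B\<close>, so both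
    suprema run over the same values.\<close>
  have "{Y. Y \<subseteq> h ` B \<and> finite Y \<and> Y \<noteq> {}} = (`) h ` {X. X \<subseteq> B \<and> finite X \<and> X \<noteq> {}}"
    by (auto simp: image_iff dest: finite_subset_image[where f = h and A = B])
  then have "rel_entropy H \<psi> (h ` B) (h ` A) =
      (SUP X \<in> {X. X \<subseteq> B \<and> finite X \<and> X \<noteq> {}}. ereal (rel_entropy_on H \<psi> (h ` A) (h ` X)))"
    by (simp add: rel_entropy_def image_image)
  also have "\<dots> = rel_entropy G \<phi> B A"
    unfolding rel_entropy_def by (intro SUP_cong refl) (simp add: on)
  finally show ?thesis .
qed

section \<open>Restrictions, quotients and the second isomorphism theorem\<close>

lemma (in group) group_endo_subgroup:
  assumes "subgroup S G" "\<phi> \<in> hom G G" "invariant_under \<phi> S"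
  shows "group_endo (G\<lparr>carrier := S\<rparr>) \<phi>"
proof -
  have "\<phi> \<in> hom (G\<lparr>carrier := S\<rparr>) (G\<lparr>carrier := S\<rparr>)"
    using assms subgroup.subset[OF assms(1)]
    by (auto simp: hom_def invariant_under_def subset_iff)
  then show ?thesis
    using subgroup_imp_group[OF assms(1)] by (simp add: group_endo_def group_endo_axioms_def)
qed

context group_endo
begin

lemma entropy_eq_rel_entropy: "entropy G \<phi> = rel_entropy G \<phi> (carrier G) {\<one>}"
  unfolding entropy_def rel_entropy_def
  by (intro SUP_cong refl)
    (simp add: entropy_on_def rel_entropy_on_def coset_card_one trajectory_closed)

lemma quotient_endo:
  assumes "N \<lhd> G" "invariant_under \<phi> N"
  shows "group_endo (G Mod N) (induced G N \<phi>)"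
  using normal.factorgroup_is_group[OF assms(1)] induced_hom[OF assms(1) endo assms(2)]
  by (simp add: group_endo_def group_endo_axioms_def)

text \<open>Transfer along the projection onto \<open>G Mod N\<close>. The kernel condition is
  stated as \<open>N \<inter> B \<subseteq> A\<close> so that it covers subgroups \<open>B\<close>
  not containing \<open>N\<close>, as in the second isomorphism theorem.\<close>

lemma rel_entropy_quotient:
  assumes N: "N \<lhd> G" "invariant_under \<phi> N"
    and B: "subgroup B G" "invariant_under \<phi> B" and A: "subgroup A G" "A \<subseteq> B" "N \<inter> B \<subseteq> A"
  shows "rel_entropy (G Mod N) (induced G N \<phi>) ((\<lambda>x. N #> x) ` B) ((\<lambda>x. N #> x) ` A) =
    rel_entropy G \<phi> B A"
proof -
  interpret N: normal N G by fact
  interpret Q: group_hom G "G Mod N" "\<lambda>x. N #> x"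
    using N.factorgroup_is_group N.r_coset_hom_Mod
    by (simp add: group_hom_def group_hom_axioms_def)
  show ?thesis
  proof (rule Q.rel_entropy_hom_image[OF B(2) _ B(1) A(1,2)])
    fix x assume "x \<in> B"
    then have x: "x \<in> carrier G"
      using subgroup.subset[OF B(1)] by auto
    show "N #> \<phi> x = induced G N \<phi> (N #> x)"
      using induced_r_coset[OF N(1) endo N(2) x] by simp
    assume "N #> x = \<one>\<^bsub>G Mod N\<^esub>"
    then have "x \<in> N"
      using rcos_self[OF x N.subgroup_axioms] by simp
    with \<open>x \<in> B\<close> show "x \<in> A"
      using A(3) by auto
  qed
qed

lemma subgroup_coset_image:
  assumes "N \<lhd> G" "S \<subseteq> N" "S \<noteq> {}"
  shows "(\<lambda>x. N #> x) ` S = {\<one>\<^bsub>G Mod N\<^esub>}"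
  using assms coset_join2[of _ N] normal_imp_subgroup[OF assms(1)] subgroup.subset[of N G]
  by (auto simp: image_iff)

lemma entropy_quotient:
  assumes "N \<lhd> G" "invariant_under \<phi> N"
  shows "entropy (G Mod N) (induced G N \<phi>) = rel_entropy G \<phi> (carrier G) N"
proof -
  interpret Q: group_endo "G Mod N" "induced G N \<phi>"
    using assms by (rule quotient_endo)
  have N: "subgroup N G"
    using assms(1) by (rule normal_imp_subgroup)
  have "(\<lambda>x. N #> x) ` N = {\<one>\<^bsub>G Mod N\<^esub>}"
    using assms(1) subgroup.one_closed[OF N] by (intro subgroup_coset_image) auto
  moreover have "invariant_under \<phi> (carrier G)"
    by (auto simp: invariant_under_def)
  ultimately show ?thesis
    using rel_entropy_quotient[OF assms subgroup_self _ N] subgroup.subset[OF N]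
    unfolding Q.entropy_eq_rel_entropy carrier_FactGroup by simp
qed

text \<open>All three entropies become relative entropies in the one group \<open>G\<close>, where
  summands from different sections can be regrouped.\<close>

lemma AT_iff:
  assumes "H \<lhd> G" "invariant_under \<phi> H"
  shows "AT G \<phi> H \<longleftrightarrow>
    rel_entropy G \<phi> (carrier G) {\<one>} = rel_entropy G \<phi> H {\<one>} + rel_entropy G \<phi> (carrier G) H"
proof -
  interpret H: group_endo "G\<lparr>carrier := H\<rparr>" \<phi>
    using normal_imp_subgroup[OF assms(1)] endo assms(2) by (rule group_endo_subgroup)
  show ?thesis
    using H.entropy_eq_rel_entropy entropy_quotient[OF assms]
    by (simp add: AT_def entropy_eq_rel_entropy)
qed

text \<open>\<open>N <#> H\<close> and \<open>H\<close> have the same image in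
  \<open>G Mod N\<close>, while \<open>N\<close> and \<open>H \<inter> N\<close> both have trivial
  image. Both sides are thus the entropy on the image of \<open>H\<close>.\<close>

lemma rel_entropy_second_iso:
  assumes N: "N \<lhd> G" "invariant_under \<phi> N" and H: "subgroup H G" "invariant_under \<phi> H"
  shows "rel_entropy G \<phi> (N <#> H) N = rel_entropy G \<phi> H (H \<inter> N)"
proof -
  have Ns: "subgroup N G"
    using N(1) by (rule normal_imp_subgroup)
  have one: "\<one> \<in> N" "\<one> \<in> H"
    using Ns H(1) by (auto intro: subgroup.one_closed)
  have sub: "N \<subseteq> carrier G" "H \<subseteq> carrier G"
    using Ns H(1) by (auto dest: subgroup.subset)
  have NH: "subgroup (N <#> H) G"
    using N(1) H(1) by (rule mult_norm_subgroup)
  have NH_inv: "invariant_under \<phi> (N <#> H)"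
    unfolding invariant_under_def
    using funpow_set_mult[OF sub, of 1] mono_set_mult[of "\<phi> ` N" N "\<phi> ` H" H G] N(2) H(2)
    by (simp add: invariant_under_def)
  have N_le: "N \<subseteq> N <#> H"
  proof
    fix x assume "x \<in> N"
    then have "x = x \<otimes> \<one>" "x \<in> N"
      using sub by auto
    then show "x \<in> N <#> H"
      unfolding set_mult_def using one(2) by blast
  qed
  have "(\<lambda>x. N #> x) ` (N <#> H) = (\<lambda>x. N #> x) ` H"
  proof -
    have eq: "N #> (n \<otimes> x) = N #> x" if "n \<in> N" "x \<in> H" for n x
      using that sub Ns coset_mult_assoc[of N n x] coset_join2[of n N] by auto
    have "(\<lambda>x. N #> x) ` (N <#> H) = (\<Union>n\<in>N. (\<lambda>x. N #> (n \<otimes> x)) ` H)"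
      unfolding set_mult_def by blast
    also have "\<dots> = (\<Union>n\<in>N. (\<lambda>x. N #> x) ` H)"
      by (intro SUP_cong image_cong refl eq)
    finally show ?thesis
      using one(1) by auto
  qed
  moreover have "(\<lambda>x. N #> x) ` N = (\<lambda>x. N #> x) ` (H \<inter> N)"
    using one by (subst (1 2) subgroup_coset_image[OF N(1)]) auto
  ultimately show ?thesis
    using rel_entropy_quotient[OF N NH NH_inv Ns N_le]
      rel_entropy_quotient[OF N H subgroups_Inter_pair[OF H(1) Ns]] by simp
qed

text \<open>The commutator condition says that the image of \<open>C\<close> is central in
  \<open>G Mod A\<close>. The central case there is pulled back term by term.\<close>

lemma rel_entropy_add_central_quotient:
  assumes A: "A \<lhd> G" "invariant_under \<phi> A" and C: "subgroup C G" "invariant_under \<phi> C"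
    and "A \<subseteq> C" and comm: "\<And>c g. c \<in> C \<Longrightarrow> g \<in> carrier G \<Longrightarrow> c \<otimes> g \<otimes> inv c \<otimes> inv g \<in> A"
  shows "rel_entropy G \<phi> (carrier G) A = rel_entropy G \<phi> C A + rel_entropy G \<phi> (carrier G) C"
proof -
  interpret A: normal A G by fact
  interpret Q: group_endo "G Mod A" "induced G A \<phi>"
    using A by (rule quotient_endo)
  interpret f: group_hom G "G Mod A" "\<lambda>x. A #> x"
    using A.factorgroup_is_group A.r_coset_hom_Mod
    by (simp add: group_hom_def group_hom_axioms_def)
  have CG: "C \<subseteq> carrier G"
    using C(1) by (rule subgroup.subset)
  let ?C = "(\<lambda>x. A #> x) ` C"
  have "subgroup ?C (G Mod A)"
    using C(1) by (rule f.subgroup_img_is_subgroup)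
  moreover have "?C \<subseteq> center (G Mod A)"
  proof -
    have "(A #> c) <#> (A #> g) = (A #> g) <#> (A #> c)" if "c \<in> C" "g \<in> carrier G" for c g
    proof -
      have cg: "c \<in> carrier G" "g \<in> carrier G"
        using that CG by auto
      then have "c \<otimes> g \<otimes> inv (g \<otimes> c) \<in> A"
        using comm[OF that] by (simp add: inv_mult_group m_assoc)
      then have "c \<otimes> g \<in> A #> (g \<otimes> c)"
        using A.rcos_module_rev[OF is_group m_closed[OF cg(2,1)] m_closed[OF cg]] by simp
      then have "A #> (g \<otimes> c) = A #> (c \<otimes> g)"
        using m_closed[OF cg(2,1)] A.subgroup_axioms by (rule repr_independence)
      then show ?thesis
        using A.rcos_sum[OF cg] A.rcos_sum[OF cg(2,1)] by metis
    qed
    then have "\<forall>D\<in>(\<lambda>x. A #> x) ` carrier G. \<forall>C\<in>?C. C <#> D = D <#> C"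
      by blast
    then show ?thesis
      unfolding center_def carrier_FactGroup mult_FactGroup using CG by blast
  qed
  moreover have "invariant_under (induced G A \<phi>) ?C"
    unfolding invariant_under_def
  proof clarify
    fix c assume "c \<in> C"
    then have "\<phi> c \<in> C" "c \<in> carrier G"
      using C(2) CG by (auto simp: invariant_under_def)
    then show "induced G A \<phi> (A #> c) \<in> ?C"
      using induced_r_coset[OF A(1) endo A(2), of c] by simp
  qed
  ultimately have "rel_entropy (G Mod A) (induced G A \<phi>) (carrier (G Mod A)) {\<one>\<^bsub>G Mod A\<^esub>} =
      rel_entropy (G Mod A) (induced G A \<phi>) ?C {\<one>\<^bsub>G Mod A\<^esub>} +
      rel_entropy (G Mod A) (induced G A \<phi>) (carrier (G Mod A)) ?C"
    by (rule Q.rel_entropy_add_central)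
  moreover have "{\<one>\<^bsub>G Mod A\<^esub>} = (\<lambda>x. A #> x) ` A"
    using A.one_closed subgroup_coset_image[OF A(1) order_refl] by (metis empty_iff)
  moreover have inv: "invariant_under \<phi> (carrier G)"
    by (auto simp: invariant_under_def)
  ultimately show ?thesis
    using rel_entropy_quotient[OF A subgroup_self inv A.subgroup_axioms A.subset Int_lower1]
      rel_entropy_quotient[OF A subgroup_self inv C(1) CG le_infI1[OF \<open>A \<subseteq> C\<close>]]
      rel_entropy_quotient[OF A C A.subgroup_axioms \<open>A \<subseteq> C\<close> Int_lower1]
    unfolding carrier_FactGroup by simp
qed

lemma derived_invariant:
  assumes "B \<subseteq> carrier G" "invariant_under \<phi> B"
  shows "invariant_under \<phi> (derived G B)"
proof -
  interpret f: group_hom G G \<phi>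
    using endo by unfold_locales
  have "\<phi> ` derived G B = derived G (\<phi> ` B)"
    using f.derived_img[OF assms(1)] by simp
  also have "\<dots> \<subseteq> derived G B"
    using assms(2) by (intro mono_derived) (simp add: invariant_under_def)
  finally show ?thesis
    by (simp add: invariant_under_def)
qed

end


section \<open>Solvable groups\<close>

text \<open>The derived series of a subgroup may be computed in the ambient group, where it can be
  compared with the series of the latter.\<close>

lemma (in group) exp_of_derived_consistent:
  assumes "subgroup S G"
  shows "(derived (G\<lparr>carrier := S\<rparr>) ^^ n) S = (derived G ^^ n) S"
proof -
  interpret S: group "G\<lparr>carrier := S\<rparr>"
    using assms by (rule subgroup_imp_group)
  show ?thesis
  proof (induction n)
    case (Suc n)
    have "(derived (G\<lparr>carrier := S\<rparr>) ^^ n) S \<subseteq> S"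
      using S.exp_of_derived_in_carrier[of S n] by simp
    then show ?case
      using Suc derived_consistent[OF _ assms] by simp
  qed simp
qed

lemma (in group) commutator_in_derived:
  assumes "x \<in> B" "y \<in> B"
  shows "x \<otimes> y \<otimes> inv x \<otimes> inv y \<in> derived G B"
  unfolding derived_def using assms by (intro generate.incl) blast

text \<open>This is the hypothesis for the quotient by \<open>H\<close>, whose derived subgroup is
  the image of \<open>H <#> D\<close>. That quotient lives in another type, so the hypothesis is
  applied to an isomorphic copy \<open>K\<close> in \<open>\<X>\<close> and pulled back.\<close>

lemma rel_entropy_add_derived_quotient:
  fixes \<X> :: "'a monoid set"
  assumes \<X>: "closed_under_quotients \<X>"
    and AT: "\<forall>G \<in> \<X>. \<forall>\<phi> \<in> hom G G. AT G \<phi> (derived G (carrier G))"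
    and L: "L \<in> \<X>" "group_endo L \<phi>" and H: "H \<lhd> L" "invariant_under \<phi> H"
  defines "D \<equiv> derived L (carrier L)"
  shows "rel_entropy L \<phi> (carrier L) H =
    rel_entropy L \<phi> (H <#>\<^bsub>L\<^esub> D) H + rel_entropy L \<phi> (carrier L) (H <#>\<^bsub>L\<^esub> D)"
proof -
  interpret L: group_endo L \<phi> by fact
  interpret H: normal H L by fact
  interpret Q: group_endo "L Mod H" "induced L H \<phi>"
    using H by (rule L.quotient_endo)
  obtain K :: "'a monoid" where K: "group K" "K \<cong> L Mod H"
    using quotient_copy_exists[OF H(1)] by auto
  then have "K \<in> \<X>"
    using \<X> L(1) H(1) unfolding closed_under_quotients_def by blast
  interpret K: group K by fact
  obtain i where i: "i \<in> iso (L Mod H) K"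
    using K.iso_sym[OF K(2)] by (auto simp: is_iso_def)
  let ?Q = "carrier (L Mod H)"
  have i_hom: "i \<in> hom (L Mod H) K" and i_inj: "inj_on i ?Q" and i_image: "i ` ?Q = carrier K"
    using i by (auto simp: iso_def bij_betw_def)
  define j where "j = inv_into ?Q i"
  have j_hom: "j \<in> hom K (L Mod H)"
    using Q.iso_set_sym[OF i] by (simp add: j_def iso_def)
  have ji: "j (i C) = C" if "C \<in> ?Q" for C
    using that i_inj by (simp add: j_def)
  \<comment> \<open>\<open>f\<close> is the projection followed by the isomorphism, with kernel
    \<open>H\<close>; \<open>\<psi>\<close> is the induced endomorphism carried over to
    \<open>K\<close>.\<close>
  define f where "f = i \<circ> (\<lambda>x. H #>\<^bsub>L\<^esub> x)"
  define \<psi> where "\<psi> = i \<circ> (induced L H \<phi> \<circ> j)"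
  have "\<psi> \<in> hom K K"
    unfolding \<psi>_def using Group.hom_compose[OF Group.hom_compose[OF j_hom Q.endo] i_hom] .
  then interpret P: group_endo K \<psi>
    by unfold_locales
  have "f \<in> hom L K"
    unfolding f_def using Group.hom_compose[OF H.r_coset_hom_Mod i_hom] .
  then interpret f: group_hom L K f
    by unfold_locales
  have coset_Q: "H #>\<^bsub>L\<^esub> x \<in> ?Q" if "x \<in> carrier L" for x
    using that by (simp add: carrier_FactGroup)
  have f_image: "f ` carrier L = carrier K"
    using i_image by (simp add: f_def image_image carrier_FactGroup)
  have intertwine: "f (\<phi> x) = \<psi> (f x)" if "x \<in> carrier L" for x
    using that by (simp add: f_def \<psi>_def ji coset_Q L.induced_r_coset[OF H(1) L.endo H(2)])
  have ker: "x \<in> H" if "x \<in> carrier L" "f x = \<one>\<^bsub>K\<^esub>" for x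
  proof -
    have "i (H #>\<^bsub>L\<^esub> x) = i \<one>\<^bsub>L Mod H\<^esub>"
      using that(2) hom_one[OF i_hom Q.group_axioms K.group_axioms] by (simp add: f_def)
    then have "H #>\<^bsub>L\<^esub> x = H"
      using inj_onD[OF i_inj] coset_Q[OF that(1)] Q.one_closed by simp
    then show ?thesis
      using L.rcos_self[OF that(1) H.subgroup_axioms] by simp
  qed
  have f_one: "f h = \<one>\<^bsub>K\<^esub>" if "h \<in> H" for h
    using that H.subgroup_axioms L.coset_join2[of h H] H.subset
      hom_one[OF i_hom Q.group_axioms K.group_axioms] by (auto simp: f_def)
  have f_H: "f ` H = {\<one>\<^bsub>K\<^esub>}"
    using f_one image_cong[OF refl f_one, of H] image_constant[OF H.one_closed] by simp
  have D: "subgroup D L" "D \<subseteq> carrier L"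
    unfolding D_def using L.derived_is_subgroup[of "carrier L"] L.derived_in_carrier by auto
  have inv_carrier: "invariant_under \<phi> (carrier L)"
    by (auto simp: invariant_under_def)
  have D_inv: "invariant_under \<phi> D"
    unfolding D_def using L.derived_invariant[OF order_refl inv_carrier] .
  let ?HD = "H <#>\<^bsub>L\<^esub> D"
  have HD: "subgroup ?HD L" "H \<subseteq> ?HD" "?HD \<subseteq> carrier L"
    using L.mult_norm_subgroup[OF H(1) D(1)] subgroup.subset
      L.subgroup_of_normal_set_mult[OF H(1) D(1)] L.normal_in_normal_set_mult[OF H(1) D(1)]
      normal_imp_subgroup by force+
  have HD_inv: "invariant_under \<phi> ?HD"
    unfolding invariant_under_def
    using L.funpow_set_mult[OF H.subset D(2), of 1] mono_set_mult[of "\<phi> ` H" H "\<phi> ` D" D L] H(2) D_inv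
    by (simp add: invariant_under_def)
  \<comment> \<open>\<open>H\<close> collapses to the unit, and the surjection \<open>f\<close> maps
    \<open>D\<close> onto the derived subgroup of \<open>K\<close>.\<close>
  have f_HD: "f ` ?HD = derived K (carrier K)"
  proof -
    have "f ` ?HD = f ` H <#>\<^bsub>K\<^esub> f ` D"
      by (rule set_mult_hom[OF f.homh H.subset D(2)])
    also have "\<dots> = f ` D"
    proof -
      have "f ` D \<subseteq> carrier K"
        using D(2) by auto
      then show ?thesis
        unfolding f_H set_mult_def by (auto simp: subset_iff)
    qed
    also have "\<dots> = derived K (carrier K)"
      unfolding D_def using f.derived_img[of "carrier L"] f_image by simp
    finally show ?thesis .
  qed
  have inv_K: "invariant_under \<psi> (derived K (carrier K))"
    by (rule P.derived_invariant) (auto simp: invariant_under_def)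
  have "AT K \<psi> (derived K (carrier K))"
    using AT \<open>K \<in> \<X>\<close> P.endo by blast
  then have "rel_entropy K \<psi> (f ` carrier L) (f ` H) =
      rel_entropy K \<psi> (f ` ?HD) (f ` H) + rel_entropy K \<psi> (f ` carrier L) (f ` ?HD)"
    unfolding P.AT_iff[OF K.derived_self_is_normal inv_K] f_image f_H f_HD .
  moreover have "rel_entropy K \<psi> (f ` carrier L) (f ` H) = rel_entropy L \<phi> (carrier L) H"
    using ker intertwine H.subset
    by (intro f.rel_entropy_hom_image inv_carrier L.subgroup_self H.subgroup_axioms)
  moreover have "rel_entropy K \<psi> (f ` ?HD) (f ` H) = rel_entropy L \<phi> ?HD H"
    using ker intertwine HD by (intro f.rel_entropy_hom_image HD_inv HD H.subgroup_axioms) auto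
  moreover have "rel_entropy K \<psi> (f ` carrier L) (f ` ?HD) = rel_entropy L \<phi> (carrier L) ?HD"
    using ker intertwine HD
    by (intro f.rel_entropy_hom_image inv_carrier L.subgroup_self HD) auto
  ultimately show ?thesis
    by simp
qed

text \<open>Induction on a bound \<open>n\<close> for the derived length, over all members of the
  class at once, since the induction hypothesis is applied to subgroups of the derived
  subgroup.\<close>

lemma rel_entropy_add_solvable:
  fixes \<X> :: "'a monoid set"
  assumes groups: "\<And>G. G \<in> \<X> \<Longrightarrow> group G"
    and subgroups: "closed_under_subgroups \<X>" and quotients: "closed_under_quotients \<X>"
    and AT: "\<forall>G \<in> \<X>. \<forall>\<phi> \<in> hom G G. AT G \<phi> (derived G (carrier G))"
    and "L \<in> \<X>" "\<phi> \<in> hom L L" "H \<lhd> L" "invariant_under \<phi> H"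
    and "(derived L ^^ n) (carrier L) = {\<one>\<^bsub>L\<^esub>}"
  shows "rel_entropy L \<phi> (carrier L) {\<one>\<^bsub>L\<^esub>} =
    rel_entropy L \<phi> H {\<one>\<^bsub>L\<^esub>} + rel_entropy L \<phi> (carrier L) H"
  using assms(5-)
proof (induction n arbitrary: L H)
  case 0
  interpret L: group_endo L \<phi>
    using groups[OF 0(1)] 0(2) by (simp add: group_endo_def group_endo_axioms_def)
  \<comment> \<open>Here the carrier is trivial, so the central case applies.\<close>
  have "H \<subseteq> center L"
    using 0(5) subgroup.subset[OF normal_imp_subgroup[OF 0(3)]] by (auto simp: center_def)
  then show ?case
    using L.rel_entropy_add_central[OF normal_imp_subgroup[OF 0(3)]] 0(4) by blast
next
  case (Suc n)
  note H = Suc.prems(3,4)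
  interpret L: group_endo L \<phi>
    using groups[OF Suc.prems(1)] Suc.prems(2) by (simp add: group_endo_def group_endo_axioms_def)
  let ?e = "rel_entropy L \<phi>" and ?D = "derived L (carrier L)" and ?H' = "derived L H"
  have inv_carrier: "invariant_under \<phi> (carrier L)"
    by (auto simp: invariant_under_def)
  have Hs: "subgroup H L" "H \<subseteq> carrier L"
    using normal_imp_subgroup[OF H(1)] subgroup.subset by auto
  have D: "?D \<lhd> L" "subgroup ?D L" "invariant_under \<phi> ?D"
    using L.derived_self_is_normal normal_imp_subgroup L.derived_invariant[OF order_refl inv_carrier]
    by auto
  have H': "?H' \<lhd> L" "subgroup ?H' L" "invariant_under \<phi> ?H'" "?H' \<subseteq> H" "?H' \<subseteq> ?D"
    using L.derived_is_normal[OF H(1)] normal_imp_subgroup L.derived_invariant[OF Hs(2) H(2)]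
      L.derived_incl[OF order_refl Hs(1)] L.mono_derived[OF Hs(2)] by auto
  have HD: "subgroup (H \<inter> ?D) L" "invariant_under \<phi> (H \<inter> ?D)"
    using L.subgroups_Inter_pair[OF Hs(1) D(2)] H(2) D(3) by (auto simp: invariant_under_def)

  have endo: "group_endo (L\<lparr>carrier := S\<rparr>) \<phi>" if "subgroup S L" "invariant_under \<phi> S" for S
    using L.group_endo_subgroup[OF that(1) L.endo that(2)] .
  have in_class: "L\<lparr>carrier := S\<rparr> \<in> \<X>" if "subgroup S L" for S
    using subgroups Suc.prems(1) that by (simp add: closed_under_subgroups_def)
  \<comment> \<open>For \<open>S\<close> inside the derived subgroup, the \<open>n\<close>-th
    derived subgroup of \<open>S\<close> lies in the \<open>Suc n\<close>-th one of
    \<open>L\<close>, which is trivial.\<close>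
  have IH: "?e S {\<one>\<^bsub>L\<^esub>} = ?e M {\<one>\<^bsub>L\<^esub>} + ?e S M"
    if S: "subgroup S L" "invariant_under \<phi> S" "S \<subseteq> ?D"
      and M: "M \<lhd> L\<lparr>carrier := S\<rparr>" "invariant_under \<phi> M" for S M
  proof -
    have "(derived L ^^ n) S \<subseteq> (derived L ^^ n) ?D"
      using S(3) by (rule L.mono_exp_of_derived)
    also have "\<dots> = {\<one>\<^bsub>L\<^esub>}"
      using Suc.prems(5) by (simp add: funpow_swap1)
    finally have "(derived L ^^ n) S = {\<one>\<^bsub>L\<^esub>}"
      using subgroup.one_closed[OF L.exp_of_derived_is_subgroup[OF S(1)]] by blast
    then show ?thesis
      using Suc.IH[OF in_class[OF S(1)] group_endo.endo[OF endo[OF S(1,2)]] M]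
        L.exp_of_derived_consistent[OF S(1)] by simp
  qed
  have derived_add: "?e S {\<one>\<^bsub>L\<^esub>} = ?e (derived L S) {\<one>\<^bsub>L\<^esub>} + ?e S (derived L S)"
    if S: "subgroup S L" "invariant_under \<phi> S" for S
  proof -
    interpret S: group_endo "L\<lparr>carrier := S\<rparr>" \<phi>
      using S by (rule endo)
    have "AT (L\<lparr>carrier := S\<rparr>) \<phi> (derived L S)"
      using AT in_class[OF S(1)] S.endo L.derived_consistent[OF order_refl S(1)] by auto
    moreover have "derived L S \<lhd> L\<lparr>carrier := S\<rparr>"
      using S(1) by (rule L.derived_subgroup_is_normal)
    moreover have "invariant_under \<phi> (derived L S)"
      using subgroup.subset[OF S(1)] S(2) by (rule L.derived_invariant)
    ultimately show ?thesis
      using S.AT_iff[of "derived L S"] by simp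
  qed
  have abelian_H: "?e H ?H' = ?e (H \<inter> ?D) ?H' + ?e H (H \<inter> ?D)"
  proof -
    interpret K: group_endo "L\<lparr>carrier := H\<rparr>" \<phi>
      using Hs(1) H(2) by (rule endo)
    have "c \<otimes>\<^bsub>L\<^esub> g \<otimes>\<^bsub>L\<^esub> inv\<^bsub>L\<lparr>carrier := H\<rparr>\<^esub> c \<otimes>\<^bsub>L\<^esub> inv\<^bsub>L\<lparr>carrier := H\<rparr>\<^esub> g \<in> ?H'"
      if "c \<in> H" "g \<in> H" for c g
      using that L.commutator_in_derived[OF that] by (simp add: L.m_inv_consistent[OF Hs(1)])
    then show ?thesis
      using K.rel_entropy_add_central_quotient[OF L.derived_subgroup_is_normal[OF Hs(1)] H'(3)
          L.subgroup_incl[OF HD(1) Hs(1) Int_lower1] HD(2)] H'(4,5) by simp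
  qed
  have abelian_L: "?e (carrier L) ?D = ?e (?D <#>\<^bsub>L\<^esub> H) ?D + ?e (carrier L) (?D <#>\<^bsub>L\<^esub> H)"
  proof (rule L.rel_entropy_add_central_quotient[OF D(1,3)])
    show sub: "subgroup (?D <#>\<^bsub>L\<^esub> H) L"
      using D(1) Hs(1) by (rule L.mult_norm_subgroup)
    show "invariant_under \<phi> (?D <#>\<^bsub>L\<^esub> H)"
      unfolding invariant_under_def
      using L.funpow_set_mult[OF subgroup.subset[OF D(2)] Hs(2), of 1]
        mono_set_mult[of "\<phi> ` ?D" ?D "\<phi> ` H" H L] H(2) D(3)
      by (simp add: invariant_under_def)
    show "?D \<subseteq> ?D <#>\<^bsub>L\<^esub> H"
      using subgroup.subset[OF normal_imp_subgroup[OF L.normal_in_normal_set_mult[OF D(1) Hs(1)]]]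
      by simp
    fix c g assume "c \<in> ?D <#>\<^bsub>L\<^esub> H" "g \<in> carrier L"
    then show "c \<otimes>\<^bsub>L\<^esub> g \<otimes>\<^bsub>L\<^esub> inv\<^bsub>L\<^esub> c \<otimes>\<^bsub>L\<^esub> inv\<^bsub>L\<^esub> g \<in> ?D"
      using subgroup.subset[OF sub] by (intro L.commutator_in_derived) auto
  qed
  \<comment> \<open>With \<open>D\<close> and \<open>H'\<close> the derived subgroups of
    \<open>L\<close> and \<open>H\<close>, five summands arise: \<open>e(H', 1)\<close>,
    \<open>e(H \<inter> D, H')\<close>, \<open>e(H, H \<inter> D)\<close>,
    \<open>e(D, H \<inter> D)\<close> and \<open>e(L, HD)\<close>. The first three sum to
    \<open>e(H, 1)\<close>; as \<open>e(D, H \<inter> D)\<close> equals \<open>e(HD, H)\<close>, the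
    last two sum to \<open>e(L, H)\<close>.\<close>
  have "?e (carrier L) {\<one>\<^bsub>L\<^esub>} = ?e ?D {\<one>\<^bsub>L\<^esub>} + ?e (carrier L) ?D"
    by (rule derived_add[OF L.subgroup_self inv_carrier])
  also have "?e ?D {\<one>\<^bsub>L\<^esub>} = ?e (H \<inter> ?D) {\<one>\<^bsub>L\<^esub>} + ?e ?D (H \<inter> ?D)"
    using L.normal_Int_subgroup[OF D(2) H(1)] HD(2) by (intro IH D order_refl)
  also have "?e (H \<inter> ?D) {\<one>\<^bsub>L\<^esub>} = ?e ?H' {\<one>\<^bsub>L\<^esub>} + ?e (H \<inter> ?D) ?H'"
    using H'(4,5) by (intro IH HD H'(3) L.normal_restrict_supergroup[OF HD(1) H'(1)]) auto
  also have "?e (carrier L) ?D = ?e H (H \<inter> ?D) + ?e (carrier L) (H <#>\<^bsub>L\<^esub> ?D)"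
    using abelian_L L.rel_entropy_second_iso[OF D(1,3) Hs(1) H(2)] L.commut_normal[OF Hs(1) D(1)]
    by simp
  finally have "?e (carrier L) {\<one>\<^bsub>L\<^esub>} =
      (?e ?H' {\<one>\<^bsub>L\<^esub>} + (?e (H \<inter> ?D) ?H' + ?e H (H \<inter> ?D))) +
      (?e ?D (H \<inter> ?D) + ?e (carrier L) (H <#>\<^bsub>L\<^esub> ?D))"
    by (simp add: ac_simps)
  also have "?e ?H' {\<one>\<^bsub>L\<^esub>} + (?e (H \<inter> ?D) ?H' + ?e H (H \<inter> ?D)) = ?e H {\<one>\<^bsub>L\<^esub>}"
    using derived_add[OF Hs(1) H(2)] abelian_H by simp
  also have "?e ?D (H \<inter> ?D) + ?e (carrier L) (H <#>\<^bsub>L\<^esub> ?D) = ?e (carrier L) H"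
    using rel_entropy_add_derived_quotient[OF quotients AT Suc.prems(1) L.group_endo_axioms H]
      L.rel_entropy_second_iso[OF H D(2,3)] by (simp add: Int_commute)
  finally show ?case .
qed


section \<open>Nilpotent groups\<close>

context group
begin

text \<open>Two cosets commute exactly when the commutator of their representatives lies in the
  subgroup. The description by elements keeps the later arguments out of the quotient.\<close>

lemma upper_central_Suc_iff:
  assumes "upper_central G n \<lhd> G"
  shows "x \<in> upper_central G (Suc n) \<longleftrightarrow>
    x \<in> carrier G \<and> (\<forall>g\<in>carrier G. x \<otimes> g \<otimes> inv x \<otimes> inv g \<in> upper_central G n)"
proof -
  interpret Z: normal "upper_central G n" G by fact
  let ?Z = "upper_central G n"
  have "?Z #> (x \<otimes> g) = ?Z #> (g \<otimes> x) \<longleftrightarrow> x \<otimes> g \<otimes> inv x \<otimes> inv g \<in> ?Z"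
    if "x \<in> carrier G" "g \<in> carrier G" for g
  proof -
    have "?Z #> (x \<otimes> g) = ?Z #> (g \<otimes> x) \<longleftrightarrow> x \<otimes> g \<in> ?Z #> (g \<otimes> x)"
      using that repr_independence[of "x \<otimes> g" ?Z "g \<otimes> x"]
        rcos_self[of "x \<otimes> g" ?Z] Z.subgroup_axioms by auto
    also have "\<dots> \<longleftrightarrow> x \<otimes> g \<otimes> inv (g \<otimes> x) \<in> ?Z"
      using that by (intro Z.rcos_module is_group) auto
    finally show ?thesis
      using that by (simp add: inv_mult_group m_assoc)
  qed
  moreover have "?Z #> x \<in> center (G Mod ?Z) \<longleftrightarrow>
      (\<forall>g\<in>carrier G. ?Z #> (x \<otimes> g) = ?Z #> (g \<otimes> x))" if "x \<in> carrier G"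
    unfolding center_def carrier_FactGroup mult_FactGroup using that by (auto simp: Z.rcos_sum)
  ultimately show ?thesis
    by auto
qed

lemma center_subgroup: "subgroup (center G) G"
proof (rule subgroupI)
  show sub: "center G \<subseteq> carrier G"
    unfolding center_def by blast
  show "center G \<noteq> {}"
    by (auto simp: center_def intro!: exI[of _ \<one>])
  fix a assume a: "a \<in> center G"
  have "inv a \<otimes> g = g \<otimes> inv a" if g: "g \<in> carrier G" for g
  proof -
    have aG: "a \<in> carrier G" and ag: "a \<otimes> g = g \<otimes> a"
      using a g unfolding center_def by blast+
    have "a \<otimes> (g \<otimes> inv a) = a \<otimes> g \<otimes> inv a"
      using aG g by (simp add: m_assoc)
    also have "\<dots> = g"
      unfolding ag using aG g by (simp add: m_assoc)
    finally show ?thesis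
      using aG g inv_solve_left'[of "g \<otimes> inv a" a g] by simp
  qed
  moreover have "inv a \<in> carrier G"
    using a sub by auto
  ultimately show "inv a \<in> center G"
    unfolding center_def by blast
  fix b assume b: "b \<in> center G"
  have "a \<otimes> b \<otimes> g = g \<otimes> (a \<otimes> b)" if g: "g \<in> carrier G" for g
  proof -
    have ab: "a \<in> carrier G" "b \<in> carrier G" and ag: "a \<otimes> g = g \<otimes> a" and bg: "b \<otimes> g = g \<otimes> b"
      using a b g unfolding center_def by blast+
    have "a \<otimes> b \<otimes> g = a \<otimes> (g \<otimes> b)"
      using ab g bg by (simp only: m_assoc)
    also have "\<dots> = a \<otimes> g \<otimes> b"
      using ab g by (simp only: m_assoc)
    also have "\<dots> = g \<otimes> (a \<otimes> b)"
      unfolding ag using ab g by (simp only: m_assoc)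
    finally show ?thesis .
  qed
  moreover have "a \<otimes> b \<in> carrier G"
    using a b sub by auto
  ultimately show "a \<otimes> b \<in> center G"
    unfolding center_def by blast
qed

text \<open>Each term is the preimage of a center, hence a subgroup. It is normal because a
  conjugate of \<open>h\<close> differs from \<open>h\<close> by a commutator in the preceding
  term.\<close>

lemma upper_central_normal: "upper_central G n \<lhd> G"
proof (induction n)
  case 0
  show ?case
    using one_is_normal by simp
next
  case (Suc n)
  let ?Z = "upper_central G n"
  interpret Z: normal ?Z G by fact
  interpret Q: group "G Mod ?Z"
    by (rule Z.factorgroup_is_group)
  interpret f: group_hom G "G Mod ?Z" "\<lambda>x. ?Z #> x"
    using Z.r_coset_hom_Mod by unfold_locales
  have mem: "x \<in> upper_central G (Suc n) \<longleftrightarrow> x \<in> carrier G \<and> ?Z #> x \<in> center (G Mod ?Z)" for x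
    by simp
  note C = Q.center_subgroup
  show ?case
  proof (rule normal_invI)
    show "subgroup (upper_central G (Suc n)) G"
    proof (rule subgroupI)
      show "upper_central G (Suc n) \<noteq> {}"
        using subgroup.one_closed[OF C] f.hom_one mem[of \<one>] by auto
      show "inv x \<in> upper_central G (Suc n)" if "x \<in> upper_central G (Suc n)" for x
        using that subgroup.m_inv_closed[OF C] f.hom_inv[of x] unfolding mem by auto
      show "x \<otimes> y \<in> upper_central G (Suc n)"
        if "x \<in> upper_central G (Suc n)" "y \<in> upper_central G (Suc n)" for x y
        using that subgroup.m_closed[OF C] f.hom_mult[of x y] unfolding mem by auto
    qed auto
    fix x h assume x: "x \<in> carrier G" and h: "h \<in> upper_central G (Suc n)"
    then have hG: "h \<in> carrier G" and comm: "h \<otimes> x \<otimes> inv h \<otimes> inv x \<in> ?Z"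
      using upper_central_Suc_iff[OF Suc] by auto
    have "x \<otimes> h \<otimes> inv x \<in> ?Z #> h"
    proof -
      have "inv (h \<otimes> x \<otimes> inv h \<otimes> inv x) = x \<otimes> h \<otimes> inv x \<otimes> inv h"
        using x hG by (simp add: inv_mult_group m_assoc)
      then have "x \<otimes> h \<otimes> inv x \<otimes> inv h \<in> ?Z"
        using Z.m_inv_closed[OF comm] by simp
      then show ?thesis
        using x hG by (intro Z.rcos_module_rev is_group) auto
    qed
    then have "?Z #> h = ?Z #> (x \<otimes> h \<otimes> inv x)"
      using hG Z.subgroup_axioms by (rule repr_independence)
    then show "x \<otimes> h \<otimes> inv x \<in> upper_central G (Suc n)"
      using x h hG unfolding mem by auto
  qed
qed

end

section \<open>Additivity along the upper central series\<close>

text \<open>Surjectivity writes every \<open>g\<close> as \<open>\<phi> k\<close>, so the commutator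
  of \<open>\<phi> x\<close> with \<open>g\<close> is the image of the one of \<open>x\<close> with
  \<open>k\<close>. A general endomorphism need not preserve the center.\<close>

lemma (in group_endo) upper_central_invariant:
  assumes surj: "\<phi> ` carrier G = carrier G"
  shows "invariant_under \<phi> (upper_central G n)"
proof (induction n)
  case 0
  show ?case
    using one_invariant by simp
next
  case (Suc n)
  interpret f: group_hom G G \<phi>
    using endo by unfold_locales
  have "\<phi> x \<in> upper_central G (Suc n)" if "x \<in> upper_central G (Suc n)" for x
  proof -
    have x: "x \<in> carrier G" "\<And>g. g \<in> carrier G \<Longrightarrow> x \<otimes> g \<otimes> inv x \<otimes> inv g \<in> upper_central G n"
      using that upper_central_Suc_iff[OF upper_central_normal] by auto
    have "\<phi> x \<otimes> g \<otimes> inv (\<phi> x) \<otimes> inv g \<in> upper_central G n" if g: "g \<in> carrier G" for g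
    proof -
      obtain k where k: "k \<in> carrier G" "g = \<phi> k"
        using surj g by (metis imageE)
      have "\<phi> (x \<otimes> k \<otimes> inv x \<otimes> inv k) \<in> upper_central G n"
        using x(2)[OF k(1)] Suc by (auto simp: invariant_under_def)
      then show ?thesis
        using x(1) k by simp
    qed
    then show ?thesis
      using x(1) upper_central_Suc_iff[OF upper_central_normal] by auto
  qed
  then show ?case
    by (auto simp: invariant_under_def)
qed

text \<open>The subgroup \<open>B\<close> is kept general because the induction hypothesis is used
  twice: for \<open>B\<close> and for the next term
  \<open>H \<inter> upper_central G (Suc n)\<close> in the role of \<open>B\<close>.\<close>

lemma (in group_endo) rel_entropy_add_upper_central:
  assumes surj: "\<phi> ` carrier G = carrier G" and H: "H \<lhd> G" "invariant_under \<phi> H"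
    and "subgroup B G" "invariant_under \<phi> B" "H \<inter> upper_central G n \<subseteq> B"
  shows "rel_entropy G \<phi> B {\<one>} =
    rel_entropy G \<phi> (H \<inter> upper_central G n) {\<one>} + rel_entropy G \<phi> B (H \<inter> upper_central G n)"
  using assms(4-)
proof (induction n arbitrary: B)
  case 0
  interpret B: group_endo "G\<lparr>carrier := B\<rparr>" \<phi>
    using 0(1) endo 0(2) by (rule group_endo_subgroup)
  have "subgroup {\<one>} (G\<lparr>carrier := B\<rparr>)"
    using normal_imp_subgroup[OF B.one_is_normal] by simp
  moreover have "{\<one>} \<subseteq> center (G\<lparr>carrier := B\<rparr>)"
    using subgroup.one_closed[OF 0(1)] subgroup.subset[OF 0(1)] by (auto simp: center_def)
  ultimately have "rel_entropy G \<phi> B {\<one>} = rel_entropy G \<phi> {\<one>} {\<one>} + rel_entropy G \<phi> B {\<one>}"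
    using B.rel_entropy_add_central[of "{\<one>}"] one_invariant by simp
  moreover have "H \<inter> upper_central G 0 = {\<one>}"
    using subgroup.one_closed[OF normal_imp_subgroup[OF H(1)]] by auto
  ultimately show ?case
    by simp
next
  case (Suc n)
  let ?H = "\<lambda>n. H \<inter> upper_central G n"
  note Z = upper_central_normal normal_imp_subgroup[OF upper_central_normal]
  have Hs: "subgroup H G"
    using H(1) by (rule normal_imp_subgroup)
  have Hn: "?H k \<lhd> G" "subgroup (?H k) G" "invariant_under \<phi> (?H k)" for k
    using normal_subgroup_intersect[OF H(1) Z(1)[of k]] subgroups_Inter_pair[OF Hs Z(2)[of k]]
      H(2) upper_central_invariant[OF surj, of k] by (auto simp: invariant_under_def)
  \<comment> \<open>By normality of \<open>H\<close>, both \<open>c\<close> and the conjugate of its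
    inverse lie in \<open>H\<close>; membership in the central term is its definition by
    commutators. Hence consecutive terms form central sections.\<close>
  have comm: "c \<otimes> g \<otimes> inv c \<otimes> inv g \<in> ?H n" if "c \<in> ?H (Suc n)" "g \<in> carrier G" for c g
  proof -
    have "c \<in> H" "c \<in> carrier G"
      using that subgroup.subset[OF Hs] by auto
    then have "g \<otimes> inv c \<otimes> inv g \<in> H"
      using that(2) normal.inv_op_closed2[OF H(1)] subgroup.m_inv_closed[OF Hs] by auto
    then have "c \<otimes> (g \<otimes> inv c \<otimes> inv g) \<in> H"
      using \<open>c \<in> H\<close> subgroup.m_closed[OF Hs] by auto
    then have "c \<otimes> g \<otimes> inv c \<otimes> inv g \<in> H"
      using that(2) \<open>c \<in> carrier G\<close> by (simp add: m_assoc)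
    moreover have "c \<otimes> g \<otimes> inv c \<otimes> inv g \<in> upper_central G n"
      using that upper_central_Suc_iff[OF Z(1), of c n] by blast
    ultimately show ?thesis
      by blast
  qed
  have mono: "?H n \<subseteq> ?H (Suc n)"
  proof
    fix x assume x: "x \<in> ?H n"
    have "x \<in> carrier G"
      using x subgroup.subset[OF Hs] by auto
    moreover have "x \<otimes> g \<otimes> inv x \<otimes> inv g \<in> upper_central G n" if g: "g \<in> carrier G" for g
    proof -
      have "g \<otimes> inv x \<otimes> inv g \<in> upper_central G n"
        using g x normal.inv_op_closed2[OF Z(1)] subgroup.m_inv_closed[OF Z(2)] by auto
      then have "x \<otimes> (g \<otimes> inv x \<otimes> inv g) \<in> upper_central G n"
        using x subgroup.m_closed[OF Z(2)] by auto
      then show ?thesis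
        using g \<open>x \<in> carrier G\<close> by (simp add: m_assoc)
    qed
    ultimately show "x \<in> ?H (Suc n)"
      using x upper_central_Suc_iff[OF Z(1), of x n] by blast
  qed
  interpret B: group_endo "G\<lparr>carrier := B\<rparr>" \<phi>
    using Suc.prems(1) endo Suc.prems(2) by (rule group_endo_subgroup)
  have "c \<otimes> g \<otimes> inv\<^bsub>G\<lparr>carrier := B\<rparr>\<^esub> c \<otimes> inv\<^bsub>G\<lparr>carrier := B\<rparr>\<^esub> g \<in> ?H n"
    if "c \<in> ?H (Suc n)" "g \<in> B" for c g
  proof -
    have "c \<in> B"
      using that Suc.prems(3) by auto
    then show ?thesis
      using comm[OF that(1), of g] that(2) subgroup.subset[OF Suc.prems(1)]
        m_inv_consistent[OF Suc.prems(1)] by auto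
  qed
  moreover have "?H n \<subseteq> B"
    using mono Suc.prems(3) by (rule order_trans)
  ultimately have "rel_entropy G \<phi> B (?H n) =
      rel_entropy G \<phi> (?H (Suc n)) (?H n) + rel_entropy G \<phi> B (?H (Suc n))"
    using B.rel_entropy_add_central_quotient[OF normal_restrict_supergroup[OF Suc.prems(1) Hn(1)]
        Hn(3) subgroup_incl[OF Hn(2) Suc.prems(1,3)] Hn(3) mono]
    by (simp del: upper_central.simps)
  \<comment> \<open>The two instances share the summand for \<open>?H n\<close>; with the central
    step above, associativity of addition gives the claim.\<close>
  moreover have "rel_entropy G \<phi> B {\<one>} = rel_entropy G \<phi> (?H n) {\<one>} + rel_entropy G \<phi> B (?H n)"
    using mono Suc.prems(3) by (intro Suc.IH Suc.prems(1,2)) auto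
  moreover have "rel_entropy G \<phi> (?H (Suc n)) {\<one>} =
      rel_entropy G \<phi> (?H n) {\<one>} + rel_entropy G \<phi> (?H (Suc n)) (?H n)"
    using mono by (intro Suc.IH Hn)
  ultimately show ?case
    by (simp add: add.assoc del: upper_central.simps)
qed

text \<open>Once the upper central series reaches \<open>G\<close>, its intersection with
  \<open>H\<close> is \<open>H\<close> itself.\<close>

lemma AT_nilpotent:
  assumes "group G" "nilpotent G" "\<phi> \<in> iso G G" "H \<lhd> G" "stable_under G \<phi> H"
  shows "AT G \<phi> H"
proof -
  interpret group_endo G \<phi>
    using assms(1,3) by (simp add: group_endo_def group_endo_axioms_def iso_def)
  have H: "invariant_under \<phi> H" "H \<subseteq> carrier G"
    using assms(4,5) subgroup.subset[OF normal_imp_subgroup]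
    by (auto simp: stable_under_def invariant_under_def)
  obtain n where n: "upper_central G n = carrier G"
    using assms(2) by (auto simp: nilpotent_def)
  have "\<phi> ` carrier G = carrier G"
    using assms(3) by (auto simp: iso_def bij_betw_def)
  then have "rel_entropy G \<phi> (carrier G) {\<one>\<^bsub>G\<^esub>} =
      rel_entropy G \<phi> H {\<one>\<^bsub>G\<^esub>} + rel_entropy G \<phi> (carrier G) H"
    using rel_entropy_add_upper_central[OF _ assms(4) H(1) subgroup_self, of n] n H(2)
    by (simp add: Int_absorb2 invariant_under_def)
  then show ?thesis
    using AT_iff[OF assms(4) H(1)] by simp
qed

theorem proposition3p3:
  fixes \<X> :: "'a monoid set"
  assumes "\<And>G. G \<in> \<X> \<Longrightarrow> group G \<and> solvable G"
    and "closed_under_subgroups \<X>"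
    and "closed_under_quotients \<X>"
  shows
    "((\<forall>G \<in> \<X>. \<forall>\<phi> \<in> hom G G. AT G \<phi> (derived G (carrier G))) \<longrightarrow>
      (\<forall>G \<in> \<X>. \<forall>\<phi> \<in> hom G G. \<forall>H. H \<lhd> G \<and> invariant_under \<phi> H \<longrightarrow> AT G \<phi> H)) \<and>
     ((\<forall>G \<in> \<X>. nilpotent G \<longrightarrow> (\<forall>\<phi> \<in> iso G G. AT G \<phi> (center G))) \<longrightarrow>
      (\<forall>G \<in> \<X>. nilpotent G \<longrightarrow>
        (\<forall>\<phi> \<in> iso G G. \<forall>H. H \<lhd> G \<and> stable_under G \<phi> H \<longrightarrow> AT G \<phi> H)))"
proof (intro conjI impI ballI allI)
  fix G \<phi> H
  assume AT: "\<forall>G \<in> \<X>. \<forall>\<phi> \<in> hom G G. AT G \<phi> (derived G (carrier G))"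
    and G: "G \<in> \<X>" "\<phi> \<in> hom G G" and H: "H \<lhd> G \<and> invariant_under \<phi> H"
  interpret group_endo G \<phi>
    using assms(1)[OF G(1)] G(2) by (simp add: group_endo_def group_endo_axioms_def)
  obtain n where "(derived G ^^ n) (carrier G) = {\<one>\<^bsub>G\<^esub>}"
    using assms(1)[OF G(1)] solvable_iff_trivial_derived_seq by auto
  then show "AT G \<phi> H"
    using rel_entropy_add_solvable[OF _ assms(2,3) AT G] assms(1) H AT_iff by blast
next
  fix G \<phi> H
  assume "G \<in> \<X>" "nilpotent G" "\<phi> \<in> iso G G" "H \<lhd> G \<and> stable_under G \<phi> H"
  then show "AT G \<phi> H"
    using assms(1) by (intro AT_nilpotent) auto
qed

end
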